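(* Let $d\ge1$, $K>0$, $U$ a non-negative polynomial of degree $4$ with strictly positive leading coefficient, and let $\Phi_t:\mathcal{X}_0\to\mathcal{X}_0$ be the flow of the anharmonic lattice system described in the context. Let $\omega$ be a time invariant state (as defined in the context). Let $f,g:\mathbb{R}^2\to\mathbb{R}$ be differentiable functions which are bounded together with their derivatives, and for $i,j\in\mathbb{Z}^d$ let $f_i(x)=f(x_i)$, $g_j(x)=g(x_j)$. Then for every $i\in\mathbb{Z}^d$, every $\alpha>1/2$ and every $b>0$, $$\lim_{t\to\infty}\ \sup_{j\in\mathbb{Z}^d:\,|i-j|>t\log^\alpha t} e^{bt}\,\{f_i,\Phi_t g_j\}(x)=0$$ for $\omega$-almost every $x$.
   Context: Configurations are $x=\{(q_i,p_i)\}_{i\in\mathbb{Z}^d}\in\mathcal{X}=(\mathbb{R}^2)^{\mathbb{Z}^d}$ with the product topology; $|i-j|=\sum_{\ell=1}^d|i_\ell-j_\ell|$. The dynamics is $\dot q_i=p_i$, $\dot p_i=-U'(q_i)-K\sum_{j:|j-i|=1}(q_i-q_j)$, $i\in\mathbb{Z}^d$. For $\nu\in\mathbb{Z}^d$, $k\in\mathbb{N}$, $\Lambda_{\nu,k}$ is the cube of center $\nu$ and side $2k+1$, $W_{\nu,k}(x)=\sum_{i\in\Lambda_{\nu,k}}\{p_i^2/2+U(q_i)+1\}+\sum_{i,j\in\Lambda_{\nu,k},|j-i|=1}\frac K4(q_i-q_j)^2$, $Q(x)=\sup_{\nu\in\mathbb{Z}^d}\sup_{k>\log^{1/d}(e+|\nu|)}W_{\nu,k}(x)/(2k+1)^d$,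 and $\mathcal{X}_0=\{x:Q(x)<\infty\}$. $\Phi_t:\mathcal{X}_0\to\mathcal{X}_0$, $t\in\mathbb{R}$, denotes the one-parameter group giving the unique global solution of the dynamics with $\Phi_0(x)=x$; $\Phi_t(x)_j$ is differentiable in each $x_i$. For a function $h$ on $\mathcal{X}$, $\Phi_t h(x)=h(\Phi_t(x))$. $\mathcal{U}$ is the algebra of local observables: functions $f(x)=f_\Lambda(x_\Lambda)$ for some bounded $\Lambda\subset\mathbb{Z}^d$ and a differentiable $f_\Lambda$ bounded with its derivatives. Poisson bracket: $\{f,g\}(x)=\sum_{i}\bigl(\frac{\partial f}{\partial q_i}\frac{\partial g}{\partial p_i}-\frac{\partial f}{\partial p_i}\frac{\partial g}{\partial q_i}\bigr)(x)$. A time invariant state is a Borel probability measure $\omega$ on $\mathcal{X}$ such that (i) there is $C_\omega>0$ with $\omega(e^{\lambda W_{\nu,k}})\le e^{C_\omega(2k+1)^d}$ for all $\nu\in\mathbb{Z}^d$, $k\in\mathbb{N}$ and all sufficiently small $\lambda>0$, and (ii) $\omega(\Phi_t f)=\omega(f)$ for all $f\in\mathcal{U}$ and $t\in\mathbb{R}$. *)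

theory Defs
  imports "HOL-Probability.Probability" "HOL-Computational_Algebra.Polynomial"
begin

type_synonym 'd cfg = "int ^ 'd \<Rightarrow> real \<times> real"

definition lnorm :: "int ^ 'd::finite \<Rightarrow> int" where
  "lnorm i = (\<Sum>l\<in>UNIV. \<bar>i $ l\<bar>)"

definition ldist :: "int ^ 'd::finite \<Rightarrow> int ^ 'd \<Rightarrow> int" where
  "ldist i j = lnorm (i - j)"

definition cube :: "int ^ 'd::finite \<Rightarrow> nat \<Rightarrow> (int ^ 'd) set" where
  "cube \<nu> k = {i. \<forall>l. \<bar>i $ l - \<nu> $ l\<bar> \<le> int k}"

definition Wloc :: "(real \<Rightarrow> real) \<Rightarrow> real \<Rightarrow> int ^ 'd::finite \<Rightarrow> nat \<Rightarrow> 'd cfg \<Rightarrow> real" where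
  "Wloc U K \<nu> k x =
     (\<Sum>i\<in>cube \<nu> k. (snd (x i))\<^sup>2 / 2 + U (fst (x i)) + 1)
   + (\<Sum>(i, j)\<in>{(i, j). i \<in> cube \<nu> k \<and> j \<in> cube \<nu> k \<and> ldist j i = 1}.
        K / 4 * (fst (x i) - fst (x j))\<^sup>2)"

definition Qfun :: "(real \<Rightarrow> real) \<Rightarrow> real \<Rightarrow> 'd::finite cfg \<Rightarrow> ereal" where
  "Qfun U K x =
     (SUP p \<in> {(\<nu>, k). real k > (ln (exp 1 + real_of_int (lnorm (\<nu> :: int ^ 'd)))) powr (1 / real CARD('d))}.
        ereal (Wloc U K (fst p) (snd p) x / (2 * real (snd p) + 1) ^ CARD('d)))"

definition X0 :: "(real \<Rightarrow> real) \<Rightarrow> real \<Rightarrow> ('d::finite cfg) set" where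
  "X0 U K = {x. Qfun U K x < \<infinity>}"

definition force :: "(real \<Rightarrow> real) \<Rightarrow> real \<Rightarrow> 'd::finite cfg \<Rightarrow> int ^ 'd \<Rightarrow> real" where
  "force U' K x i = - U' (fst (x i)) - K * (\<Sum>j\<in>{j. ldist j i = 1}. fst (x i) - fst (x j))"

text \<open>Phi is the flow of the dynamics on X0: a one-parameter group of maps X0 -> X0 whose
  orbits solve the equations of motion (with Q bounded on bounded time intervals, the class in
  which the solution is unique), and Phi_t(x)_j is differentiable in each x_i.\<close>
definition is_flow :: "(real \<Rightarrow> real) \<Rightarrow> (real \<Rightarrow> real) \<Rightarrow> real \<Rightarrow> (real \<Rightarrow> 'd::finite cfg \<Rightarrow> 'd cfg) \<Rightarrow> bool" where
  "is_flow U U' K \<Phi> \<longleftrightarrow>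
     (\<forall>x\<in>X0 U K. \<forall>t. \<Phi> t x \<in> X0 U K) \<and>
     (\<forall>x\<in>X0 U K. \<Phi> 0 x = x) \<and>
     (\<forall>x\<in>X0 U K. \<forall>s t. \<Phi> (s + t) x = \<Phi> s (\<Phi> t x)) \<and>
     (\<forall>x\<in>X0 U K. \<forall>i t.
        ((\<lambda>t. fst (\<Phi> t x i)) has_real_derivative snd (\<Phi> t x i)) (at t) \<and>
        ((\<lambda>t. snd (\<Phi> t x i)) has_real_derivative force U' K (\<Phi> t x) i) (at t)) \<and>
     (\<forall>x\<in>X0 U K. \<forall>T. \<exists>B. \<forall>t. \<bar>t\<bar> \<le> T \<longrightarrow> Qfun U K (\<Phi> t x) \<le> ereal B) \<and>
     (\<forall>x\<in>X0 U K. \<forall>t i j s.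
        (\<lambda>s. \<Phi> t (x(i := (s, snd (x i)))) j) differentiable (at s) \<and>
        (\<lambda>s. \<Phi> t (x(i := (fst (x i), s))) j) differentiable (at s))"

definition local_obs :: "('d::finite cfg \<Rightarrow> real) \<Rightarrow> bool" where
  "local_obs f \<longleftrightarrow> (\<exists>\<Lambda>. finite \<Lambda> \<and>
     (\<forall>x y. (\<forall>i\<in>\<Lambda>. x i = y i) \<longrightarrow> f x = f y) \<and>
     (\<exists>D B. \<forall>x. \<bar>f x\<bar> \<le> B \<and> (\<forall>i\<in>\<Lambda>. norm (D x i) \<le> B) \<and>
        (\<forall>\<epsilon>>0. \<exists>\<delta>>0. \<forall>y. (\<forall>i. i \<notin> \<Lambda> \<longrightarrow> y i = x i) \<and> (\<Sum>i\<in>\<Lambda>. norm (y i - x i)) < \<delta> \<longrightarrow>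
            \<bar>f y - f x - (\<Sum>i\<in>\<Lambda>. inner (D x i) (y i - x i))\<bar> \<le> \<epsilon> * (\<Sum>i\<in>\<Lambda>. norm (y i - x i)))))"

definition time_invariant_state ::
  "(real \<Rightarrow> real) \<Rightarrow> real \<Rightarrow> (real \<Rightarrow> 'd::finite cfg \<Rightarrow> 'd cfg) \<Rightarrow> 'd cfg measure \<Rightarrow> bool" where
  "time_invariant_state U K \<Phi> \<omega> \<longleftrightarrow>
     prob_space \<omega> \<and> sets \<omega> = sets borel \<and>
     (\<exists>C>0. \<exists>lam0>0. \<forall>lam. 0 < lam \<and> lam \<le> lam0 \<longrightarrow> (\<forall>\<nu> k.
        (\<integral>\<^sup>+ x. ennreal (exp (lam * Wloc U K \<nu> k x)) \<partial>\<omega>)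
          \<le> ennreal (exp (C * (2 * real k + 1) ^ CARD('d))))) \<and>
     (\<forall>f. local_obs f \<longrightarrow> (\<forall>t. (\<integral>x. f (\<Phi> t x) \<partial>\<omega>) = (\<integral>x. f x \<partial>\<omega>)))"

definition dq :: "int ^ 'd::finite \<Rightarrow> ('d cfg \<Rightarrow> real) \<Rightarrow> 'd cfg \<Rightarrow> real" where
  "dq i h x = deriv (\<lambda>s. h (x(i := (s, snd (x i))))) (fst (x i))"

definition dp :: "int ^ 'd::finite \<Rightarrow> ('d cfg \<Rightarrow> real) \<Rightarrow> 'd cfg \<Rightarrow> real" where
  "dp i h x = deriv (\<lambda>s. h (x(i := (fst (x i), s)))) (snd (x i))"

definition pbracket :: "('d::finite cfg \<Rightarrow> real) \<Rightarrow> ('d cfg \<Rightarrow> real) \<Rightarrow> 'd cfg \<Rightarrow> real" where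
  "pbracket f g x = infsum (\<lambda>i. dq i f x * dp i g x - dp i f x * dq i g x) UNIV"

end

theory Submission
  imports Defs "HOL-Real_Asymp.Real_Asymp"
begin

text \<open>
  Gronwall-type estimates with exponential weights control everything. Let \<open>r\<close> be the distance to
  a fixed site. The energy current between neighbours is bounded by the local energies, so the sum
  of \<open>exp (- 3 * r)\<close> times the local energies grows at most exponentially in time; this turns a
  logarithmic bound on the energies at time \<open>m\<close> into one on \<open>[m, m + 1]\<close>. The exponential
  moments and invariance, used only at integer times, show that almost every orbit satisfies
  \<open>q\<^sub>k(\<tau>)\<^sup>2 \<le> A * sqrt (ln (e + t + |k|))\<close> for all sites \<open>k\<close> and all \<open>\<tau> \<le> t\<close>.
  As the second derivative of \<open>P\<close> is quadratic, the difference of two orbits starting from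
  configurations that differ only at \<open>i\<close> then obeys a linear differential inequality with rate \<open>L\<^sub>k\<close> of order \<open>sqrt (ln (e + t + |k|))\<close> at site
  \<open>k\<close>, and a weight containing \<open>exp ((t - \<tau>) * L\<^sub>k)\<close> yields
  \<open>|\<partial>\<Phi>\<^sub>t(x)\<^sub>j / \<partial>x\<^sub>i| \<le> exp (- 3 / 2 * |i - j| + C * t * sqrt (ln (e + t + |i|)) + C * t)\<close>. For
  \<open>|i - j| > t * (ln t) powr \<alpha>\<close> with \<open>\<alpha> > 1 / 2\<close> the first term in the exponent dominates.
\<close>

section \<open>Sums over the lattice\<close>

text \<open>The square root of the logarithm, and with it the threshold \<open>1 / 2\<close>,
  reflects the degree of \<open>P\<close>: exponential moments allow energies of logarithmic order,
  and a quartic potential turns a bound on the energy into one on \<open>q ^ 4\<close>. Three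
  obstacles shape the argument. The system is infinite and its rates are unbounded in space, so
  differential inequalities are integrated over finite balls, and crude bounds with constants
  depending on the orbit make the boundary shell negligible. Invariance concerns only bounded
  differentiable local observables, so exponentials of the energy are reached as limits of such
  observables. Almost sure statements combine only over countably many events, so a deterministic
  estimate, with constants independent of the orbit, has to fill the time intervals in
  between.\<close>

lemma lnorm_nonneg [simp]: "0 \<le> lnorm k"
  by (simp add: lnorm_def sum_nonneg)

lemma lnorm_minus_commute: "lnorm (k - l) = lnorm (l - k)"
  by (simp add: lnorm_def abs_minus_commute)

lemma lnorm_triangle: "lnorm (k + l) \<le> lnorm k + lnorm l"
  by (simp add: lnorm_def flip: sum.distrib) (intro sum_mono abs_triangle_ineq)

lemma lnorm_component_le: "\<bar>k $ l\<bar> \<le> lnorm k"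
  unfolding lnorm_def by (rule member_le_sum) auto

definition rnorm :: "int ^ 'd::finite \<Rightarrow> real" where
  "rnorm k = real_of_int (lnorm k)"

lemma rnorm_nonneg [simp]: "0 \<le> rnorm k"
  by (simp add: rnorm_def)

lemma rnorm_triangle: "rnorm (k + l) \<le> rnorm k + rnorm l"
  unfolding rnorm_def using lnorm_triangle[of k l] by linarith

lemma rnorm_triangle': "rnorm k \<le> rnorm l + rnorm (k - l)"
  using rnorm_triangle[of l "k - l"] by simp

lemma rnorm_0 [simp]: "rnorm 0 = 0"
  by (simp add: rnorm_def lnorm_def)

lemma rnorm_component_le: "\<bar>real_of_int (k $ l)\<bar> \<le> rnorm k"
  unfolding rnorm_def using lnorm_component_le[of k l] by linarith

definition nbrs :: "int ^ 'd::finite \<Rightarrow> (int ^ 'd) set" where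
  "nbrs k = {l. ldist l k = 1}"

definition lball :: "int ^ 'd::finite \<Rightarrow> nat \<Rightarrow> (int ^ 'd) set" where
  "lball j R = {k. lnorm (k - j) \<le> int R}"

lemma finite_cube: "finite (cube \<nu> k)"
proof (rule finite_subset)
  show "cube \<nu> k \<subseteq> vec_lambda ` (PiE UNIV (\<lambda>l. {\<nu> $ l - int k..\<nu> $ l + int k}))"
  proof
    fix i assume "i \<in> cube \<nu> k"
    then have "\<bar>i $ l - \<nu> $ l\<bar> \<le> int k" for l
      by (simp add: cube_def)
    then have "i $ l \<in> {\<nu> $ l - int k..\<nu> $ l + int k}" for l
      by (smt (verit) atLeastAtMost_iff)
    then have "(\<lambda>l. i $ l) \<in> PiE UNIV (\<lambda>l. {\<nu> $ l - int k..\<nu> $ l + int k})"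
      by (simp add: PiE_UNIV_domain)
    then show "i \<in> vec_lambda ` (PiE UNIV (\<lambda>l. {\<nu> $ l - int k..\<nu> $ l + int k}))"
      by (rule rev_image_eqI) (simp add: vec_nth_inverse)
  qed
  show "finite (vec_lambda ` (PiE UNIV (\<lambda>l. {\<nu> $ l - int k..\<nu> $ l + int k})))"
    by (rule finite_imageI, rule finite_PiE) simp_all
qed

lemma finite_lball: "finite (lball j R)"
proof (rule finite_subset[OF _ finite_cube[of j R]])
  have "\<bar>k $ l - j $ l\<bar> \<le> int R" if "lnorm (k - j) \<le> int R" for k l
    using lnorm_component_le[of "k - j" l] that by simp
  then show "lball j R \<subseteq> cube j R"
    by (auto simp: lball_def cube_def)
qed

lemma lball_mono: "lball j R \<subseteq> lball j (Suc R)"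
  by (auto simp: lball_def)

lemma self_in_lball: "j \<in> lball j R"
  by (simp add: lball_def lnorm_def)

lemma nbrs_subset_lball: "nbrs k \<subseteq> lball k 1"
  by (auto simp: nbrs_def lball_def ldist_def)

lemma finite_nbrs [simp]: "finite (nbrs k)"
  by (rule finite_subset[OF nbrs_subset_lball finite_lball])

lemma nbrs_sym: "l \<in> nbrs k \<longleftrightarrow> k \<in> nbrs l"
  by (simp add: nbrs_def ldist_def lnorm_minus_commute)

definition nnbrs :: "'d::finite itself \<Rightarrow> real" where
  "nnbrs _ = real (card (nbrs (0 :: int ^ 'd)))"

lemma nnbrs_nonneg [simp]: "0 \<le> nnbrs TYPE('d::finite)"
  by (simp add: nnbrs_def)

lemma card_nbrs: "real (card (nbrs (k :: int ^ 'd::finite))) = nnbrs TYPE('d)"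
proof -
  have "bij_betw (\<lambda>l. l + k) (nbrs 0) (nbrs k)"
    by (rule bij_betw_byWitness[where f' = "\<lambda>l. l - k"]) (auto simp: nbrs_def ldist_def)
  then show ?thesis
    by (simp add: nnbrs_def bij_betw_same_card)
qed

lemma rnorm_nbrs_diff:
  assumes "l \<in> nbrs k"
  shows "rnorm (l - j) \<le> rnorm (k - j) + 1" "rnorm l \<le> rnorm k + 1"
proof -
  have "rnorm (l - k) = 1"
    using assms by (simp add: nbrs_def ldist_def rnorm_def)
  then show "rnorm (l - j) \<le> rnorm (k - j) + 1" "rnorm l \<le> rnorm k + 1"
    using rnorm_triangle'[of "l - j" "k - j"] rnorm_triangle'[of l k] by simp_all
qed

lemma lball_Suc_nbrs: "k \<in> lball j R \<Longrightarrow> l \<in> nbrs k \<Longrightarrow> l \<in> lball j (Suc R)"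
  using rnorm_nbrs_diff(1)[of l k j] by (simp add: lball_def rnorm_def)

section \<open>Summable weights on the lattice\<close>

lemma sum_lattice_prod_le:
  fixes \<phi> :: "int \<Rightarrow> real" and F :: "(int ^ 'd::finite) set"
  assumes "\<And>m. 0 \<le> \<phi> m" and "\<And>G. finite G \<Longrightarrow> sum \<phi> G \<le> s" and "finite F"
  shows "(\<Sum>k\<in>F. \<Prod>l\<in>UNIV. \<phi> (k $ l)) \<le> s ^ CARD('d)"
proof -
  \<comment> \<open>\<open>G\<close> collects all coordinates of all sites of \<open>F\<close>, so
    that \<open>F\<close> lies in a box over which the sum of products is a product of sums.\<close>
  define G where "G = (\<lambda>(k, l). k $ l) ` (F \<times> (UNIV :: 'd set))"
  have "finite G"
    using assms(3) by (simp add: G_def)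
  have "(\<Sum>k\<in>F. \<Prod>l\<in>UNIV. \<phi> (k $ l)) = (\<Sum>h\<in>vec_nth ` F. \<Prod>l\<in>UNIV. \<phi> (h l))"
    by (subst sum.reindex) (auto simp: inj_on_def vec_nth_inject)
  also have "(\<Sum>h\<in>vec_nth ` F. \<Prod>l\<in>UNIV. \<phi> (h l))
      \<le> (\<Sum>h\<in>PiE (UNIV :: 'd set) (\<lambda>_. G). \<Prod>l\<in>UNIV. \<phi> (h l))"
  proof (rule sum_mono2)
    show "finite (PiE (UNIV :: 'd set) (\<lambda>_. G))"
      using \<open>finite G\<close> by (intro finite_PiE) auto
    show "vec_nth ` F \<subseteq> PiE (UNIV :: 'd set) (\<lambda>_. G)"
      by (force simp: G_def)
  qed (intro prod_nonneg ballI assms(1))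
  also have "\<dots> = (\<Prod>l\<in>(UNIV::'d set). \<Sum>m\<in>G. \<phi> m)"
    using \<open>finite G\<close> by (subst prod_sum_PiE) auto
  also have "\<dots> = (\<Sum>m\<in>G. \<phi> m) ^ CARD('d)"
    by simp
  also have "\<dots> \<le> s ^ CARD('d)"
    using assms(1,2) \<open>finite G\<close> by (intro power_mono sum_nonneg) auto
  finally show ?thesis .
qed

lemma sum_inverse_squares_int_le:
  assumes "finite G"
  shows "(\<Sum>m\<in>G. inverse ((1 + \<bar>real_of_int m\<bar>)\<^sup>2)) \<le> 4"
proof -
  let ?f = "\<lambda>m::int. inverse ((1 + \<bar>real_of_int m\<bar>)\<^sup>2)"
  \<comment> \<open>The bound telescopes: with \<open>a = 1 + N\<close> the new term is at most
    \<open>2 / (a * (a + 1)) = 2 / a - 2 / (a + 1)\<close>.\<close>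
  have tele: "(\<Sum>n<N. inverse ((1 + real n)\<^sup>2)) \<le> 2 - 2 / (real N + 1)" for N
  proof (induction N)
    case (Suc N)
    define a where "a = 1 + real N"
    have "1 \<le> a"
      by (simp add: a_def)
    have "inverse (a\<^sup>2) = 2 / (a * (2 * a))"
      by (simp add: power2_eq_square inverse_eq_divide)
    also have "\<dots> \<le> 2 / (a * (a + 1))"
      using \<open>1 \<le> a\<close> by (intro divide_left_mono mult_left_mono) auto
    also have "\<dots> = 2 / a - 2 / (a + 1)"
      using \<open>1 \<le> a\<close> by (simp add: divide_simps)
    finally show ?case
      using Suc by (simp add: a_def add_ac)
  qed simp
  have fin: "(\<Sum>n\<in>H. inverse ((1 + real n)\<^sup>2)) \<le> 2" if fin_H: "finite H" for H
  proof -
    obtain N where "H \<subseteq> {..<N}"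
      using fin_H unfolding finite_nat_iff_bounded by blast
    then have "(\<Sum>n\<in>H. inverse ((1 + real n)\<^sup>2)) \<le> (\<Sum>n<N. inverse ((1 + real n)\<^sup>2))"
      by (intro sum_mono2) auto
    also have "\<dots> \<le> 2"
      using tele[of N] divide_nonneg_nonneg[of 2 "real N + 1"] by linarith
    finally show ?thesis .
  qed
  define H where "H = (\<lambda>m. nat \<bar>m\<bar>) ` G"
  have "finite H"
    using assms by (simp add: H_def)
  have "G \<subseteq> int ` H \<union> (\<lambda>n. - int n) ` H"
  proof
    fix m assume "m \<in> G"
    then have "nat \<bar>m\<bar> \<in> H"
      by (simp add: H_def)
    moreover have "m = int (nat \<bar>m\<bar>) \<or> m = - int (nat \<bar>m\<bar>)"
      by linarith
    ultimately show "m \<in> int ` H \<union> (\<lambda>n. - int n) ` H"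
      by blast
  qed
  then have "sum ?f G \<le> sum ?f (int ` H \<union> (\<lambda>n. - int n) ` H)"
    using \<open>finite H\<close> by (intro sum_mono2) auto
  also have "\<dots> \<le> sum ?f (int ` H) + sum ?f ((\<lambda>n. - int n) ` H)"
    using sum.union_inter[of "int ` H" "(\<lambda>n. - int n) ` H" ?f] \<open>finite H\<close>
      sum_nonneg[of "int ` H \<inter> (\<lambda>n. - int n) ` H" ?f] by simp
  also have "\<dots> = 2 * (\<Sum>n\<in>H. inverse ((1 + real n)\<^sup>2))"
    by (simp add: sum.reindex inj_on_def)
  also have "\<dots> \<le> 4"
    using fin[OF \<open>finite H\<close>] by simp
  finally show ?thesis .
qed

lemma prod_inverse_squares_ge:
  fixes k :: "int ^ 'd::finite"
  assumes "1 + rnorm k \<le> y"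
  shows "inverse (y ^ (2 * CARD('d))) \<le> (\<Prod>l\<in>UNIV. inverse ((1 + \<bar>real_of_int (k $ l)\<bar>)\<^sup>2))"
proof -
  have y: "0 < y"
    using assms rnorm_nonneg[of k] by linarith
  have "inverse (y ^ (2 * CARD('d))) = (\<Prod>l\<in>(UNIV :: 'd set). inverse (y\<^sup>2))"
    by (simp add: power_mult power_inverse)
  also have "\<dots> \<le> (\<Prod>l\<in>UNIV. inverse ((1 + \<bar>real_of_int (k $ l)\<bar>)\<^sup>2))"
  proof (intro prod_mono conjI le_imp_inverse_le power_mono)
    show "1 + \<bar>real_of_int (k $ l)\<bar> \<le> y" for l
      using assms rnorm_component_le[of k l] by linarith
  qed (use y in \<open>auto intro!: zero_less_power add_pos_nonneg\<close>)
  finally show ?thesis .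
qed

lemma sum_lattice_inverse_powers_le:
  fixes F :: "(int ^ 'd::finite) set"
  assumes "finite F"
  shows "(\<Sum>k\<in>F. inverse ((1 + rnorm (k - j)) ^ (2 * CARD('d)))) \<le> 4 ^ CARD('d)"
proof -
  have "(\<Sum>k\<in>F. inverse ((1 + rnorm (k - j)) ^ (2 * CARD('d))))
      = (\<Sum>k\<in>(\<lambda>k. k - j) ` F. inverse ((1 + rnorm k) ^ (2 * CARD('d))))"
    by (subst sum.reindex) (auto simp: inj_on_def)
  also have "\<dots> \<le> (\<Sum>k\<in>(\<lambda>k. k - j) ` F. \<Prod>l\<in>UNIV. inverse ((1 + \<bar>real_of_int (k $ l)\<bar>)\<^sup>2))"
    by (intro sum_mono prod_inverse_squares_ge) simp
  also have "\<dots> \<le> 4 ^ CARD('d)"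
    using assms by (intro sum_lattice_prod_le sum_inverse_squares_int_le) auto
  finally show ?thesis .
qed

lemma power_le_fact_exp: "0 \<le> x \<Longrightarrow> x ^ n \<le> fact n * exp (x :: real)"
proof -
  assume "0 \<le> x"
  then have "(\<Sum>i\<in>{n}. x ^ i /\<^sub>R fact i) \<le> exp x"
    unfolding exp_def by (intro sum_le_suminf summable_exp_generic) auto
  then show ?thesis
    by (simp add: field_simps)
qed

text \<open>The exponential dominates the inverse power of order \<open>2 * CARD('d)\<close>,
  uniformly in \<open>j\<close>. This is the unit of decay spent whenever a weighted sum has to be
  bounded.\<close>

lemma sum_lattice_exp_le:
  obtains S :: real where "1 \<le> S"
    "\<And>(F :: (int ^ 'd::finite) set) j. finite F \<Longrightarrow> (\<Sum>k\<in>F. exp (- rnorm (k - j))) \<le> S"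
proof
  define c :: real where "c = fact (2 * CARD('d)) * exp 1"
  have "1 \<le> c"
    using mult_mono[of 1 "fact (2 * CARD('d)) :: real" 1 "exp 1"] by (simp add: c_def)
  then show "1 \<le> c * 4 ^ CARD('d)"
    using mult_mono[of 1 c 1 "4 ^ CARD('d)"] by simp
  fix F :: "(int ^ 'd) set" and j
  assume "finite F"
  have "exp (- rnorm (k - j)) \<le> c * inverse ((1 + rnorm (k - j)) ^ (2 * CARD('d)))" for k :: "int ^ 'd"
  proof -
    define y where "y = 1 + rnorm (k - j)"
    have "0 < y ^ (2 * CARD('d))"
      by (simp add: y_def add_pos_nonneg)
    moreover have "y ^ (2 * CARD('d)) \<le> fact (2 * CARD('d)) * exp y"
      by (rule power_le_fact_exp) (simp add: y_def)
    moreover have "exp (- rnorm (k - j)) = exp 1 * inverse (exp y)"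
      by (simp add: y_def exp_add exp_minus)
    moreover have "inverse (exp y) \<le> fact (2 * CARD('d)) * inverse (y ^ (2 * CARD('d)))"
      using calculation(1,2) by (simp add: divide_simps)
    ultimately show ?thesis
      unfolding y_def[symmetric] c_def by (simp add: mult.assoc mult.left_commute)
  qed
  then have "(\<Sum>k\<in>F. exp (- rnorm (k - j)))
      \<le> c * (\<Sum>k\<in>F. inverse ((1 + rnorm (k - j)) ^ (2 * CARD('d))))"
    by (subst sum_distrib_left) (intro sum_mono)
  also have "\<dots> \<le> c * 4 ^ CARD('d)"
    using \<open>1 \<le> c\<close> \<open>finite F\<close> by (intro mult_left_mono sum_lattice_inverse_powers_le) auto
  finally show "(\<Sum>k\<in>F. exp (- rnorm (k - j))) \<le> c * 4 ^ CARD('d)" .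
qed

section \<open>Weighted comparison\<close>

abbreviation lnw :: "real \<Rightarrow> int ^ 'd::finite \<Rightarrow> real" where
  "lnw t k \<equiv> ln (exp 1 + t + rnorm k)"

text \<open>Up to a constant, the size of \<open>q\<^sup>2\<close> at a site whose quartic energy is
  of order \<open>lnw t k\<close>, and hence the growth rate of perturbations there. With
  \<open>t\<close> inside the logarithm one rate serves for all times up to
  \<open>t\<close>.\<close>

definition lw :: "real \<Rightarrow> int ^ 'd::finite \<Rightarrow> real" where
  "lw t k = sqrt (lnw t k)"

lemma lnw_ge_1: "0 \<le> t \<Longrightarrow> 1 \<le> lnw t k"
  using rnorm_nonneg[of k] by (subst ln_ge_iff) (auto intro!: add_pos_nonneg)

lemma lw_ge_1: "0 \<le> t \<Longrightarrow> 1 \<le> lw t k"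
  by (simp add: lw_def lnw_ge_1)

lemma lnw_mono: "0 \<le> s \<Longrightarrow> s \<le> t \<Longrightarrow> lnw s k \<le> lnw t k"
  by (subst ln_le_cancel_iff) (auto intro!: add_pos_nonneg)

text \<open>By concavity \<open>ln (y + r) \<le> ln y + r / y\<close> with \<open>y \<ge> 1\<close>,
  and \<open>ln y \<ge> 1\<close> turns the added \<open>r\<close> into a factor. The price
  \<open>1 + r\<close> is negligible against exponential weights.\<close>

lemma lnw_shift: "0 \<le> t \<Longrightarrow> lnw t k \<le> lnw t j * (1 + rnorm (k - j))"
proof -
  assume "0 \<le> t"
  define y where "y = exp 1 + t + rnorm j"
  have "1 \<le> y"
    using \<open>0 \<le> t\<close> by (simp add: y_def add_increasing2)
  have "lnw t k \<le> ln (y + rnorm (k - j))"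
    using \<open>0 \<le> t\<close> rnorm_triangle'[of k j]
    by (subst ln_le_cancel_iff) (auto simp: y_def intro!: add_pos_nonneg)
  also have "\<dots> \<le> ln y + rnorm (k - j) / y"
    using \<open>1 \<le> y\<close> ln_diff_le[of "y + rnorm (k - j)" y] by (simp add: add_pos_nonneg)
  also have "\<dots> \<le> ln y + rnorm (k - j) * ln y"
  proof -
    have "rnorm (k - j) / y \<le> rnorm (k - j) / 1"
      using \<open>1 \<le> y\<close> by (intro divide_left_mono) auto
    also have "\<dots> \<le> rnorm (k - j) * ln y"
      using mult_left_mono[OF lnw_ge_1[OF \<open>0 \<le> t\<close>, of j] rnorm_nonneg[of "k - j"]] by (simp add: y_def)
    finally show ?thesis by simp
  qed
  finally show ?thesis
    by (simp add: y_def algebra_simps)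
qed

lemma lnw_nbrs: "0 \<le> t \<Longrightarrow> l \<in> nbrs k \<Longrightarrow> lnw t l \<le> 2 * lnw t k"
  using lnw_shift[of t l k] by (simp add: nbrs_def ldist_def rnorm_def)

lemma lnw_le: "lnw 0 k \<le> exp 1 + rnorm k"
  using ln_le_minus_one[of "exp 1 + rnorm k"] by (simp add: add_pos_nonneg)

lemma lw_mono: "0 \<le> s \<Longrightarrow> s \<le> t \<Longrightarrow> lw s k \<le> lw t k"
  unfolding lw_def by (intro real_sqrt_le_mono lnw_mono)

lemma sqrt_diff_le: "1 \<le> x \<Longrightarrow> x \<le> y \<Longrightarrow> sqrt y - sqrt x \<le> y - (x::real)"
proof -
  assume "1 \<le> x" "x \<le> y"
  then have "1 \<le> sqrt y + sqrt x" "0 \<le> sqrt y - sqrt x"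
    using real_sqrt_ge_one[of x] real_sqrt_ge_zero[of y] by (auto simp: add_increasing)
  then have "(sqrt y - sqrt x) * 1 \<le> (sqrt y - sqrt x) * (sqrt y + sqrt x)"
    by (intro mult_left_mono)
  also have "\<dots> = y - x"
    using \<open>1 \<le> x\<close> \<open>x \<le> y\<close> by (simp add: algebra_simps)
  finally show ?thesis by simp
qed

text \<open>The square root is 1-Lipschitz on \<open>[1, \<infinity>)\<close>, and the slope of the
  logarithm from \<open>y\<close> on is at most \<open>1 / y\<close> with \<open>y \<ge> t\<close>,
  so the factor \<open>t\<close> is compensated. This relies on the \<open>t\<close> inside the
  logarithm.\<close>

lemma lw_nbrs_diff:
  assumes "0 \<le> t" "l \<in> nbrs k"
  shows "t * (lw t l - lw t k) \<le> 1"
proof (cases "lw t l \<le> lw t k")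
  case True
  then show ?thesis
    using assms(1) by (smt (verit) mult_nonneg_nonpos)
next
  case False
  define y where "y = exp 1 + t + rnorm k"
  define y' where "y' = exp 1 + t + rnorm l"
  have y: "0 < y" "t \<le> y" "0 < y'" "y' \<le> y + 1" "1 \<le> ln y"
    using assms(1) rnorm_nbrs_diff(2)[OF assms(2)] lnw_ge_1[OF assms(1), of k]
    by (auto simp: y_def y'_def intro!: add_pos_nonneg)
  have lw: "lw t k = sqrt (ln y)" "lw t l = sqrt (ln y')"
    by (simp_all add: lw_def y_def y'_def)
  then have "ln y < ln y'"
    using False by simp
  then have "lw t l - lw t k \<le> ln y' - ln y"
    unfolding lw using y by (intro sqrt_diff_le) auto
  also have "\<dots> \<le> (y' - y) / y"
    using y by (intro ln_diff_le) auto
  also have "\<dots> \<le> 1 / y"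
    using y by (intro divide_right_mono) auto
  finally have "t * (lw t l - lw t k) \<le> t * (1 / y)"
    using assms(1) by (rule mult_left_mono)
  also have "\<dots> \<le> 1"
    using y by simp
  finally show ?thesis .
qed

text \<open>From \<open>2 * u * s \<le> u\<^sup>2 + s\<^sup>2\<close> with
  \<open>s = lw t k\<close>: the growth in \<open>k\<close> is only polynomial. The Gaussian factor
  in \<open>t\<close> is far from sharp, but it enters only the constant of a boundary term that
  vanishes in the limit.\<close>

lemma exp_lw_le:
  assumes "0 \<le> t" "0 \<le> A"
  shows "exp (t * (A * lw t k)) \<le> exp ((t * A)\<^sup>2) * (exp 1 + t + rnorm k)"
proof -
  have "2 * (t * A) * lw t k \<le> (t * A)\<^sup>2 + (lw t k)\<^sup>2"
    by (rule sum_squares_bound)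
  moreover have "0 \<le> (t * A)\<^sup>2 + (lw t k)\<^sup>2"
    by simp
  ultimately have "t * (A * lw t k) \<le> (t * A)\<^sup>2 + (lw t k)\<^sup>2"
    unfolding mult.assoc by linarith
  also have "(lw t k)\<^sup>2 = ln (exp 1 + t + rnorm k)"
    using lnw_ge_1[OF assms(1), of k] by (simp add: lw_def)
  finally have "exp (t * (A * lw t k)) \<le> exp ((t * A)\<^sup>2 + ln (exp 1 + t + rnorm k))"
    by simp
  also have "\<dots> = exp ((t * A)\<^sup>2) * (exp 1 + t + rnorm k)"
    using assms(1) by (simp add: exp_add add_pos_nonneg)
  finally show ?thesis .
qed

text \<open>Reverse the pairs \<open>(k, l)\<close> of neighbours: every \<open>l\<close> that
  occurs lies in the next larger ball and is counted at most once for each of its own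
  neighbours.\<close>

lemma sum_nbrs_le:
  fixes z :: "int ^ 'd::finite \<Rightarrow> real"
  assumes "\<And>k. 0 \<le> z k"
  shows "(\<Sum>k\<in>lball j R. \<Sum>l\<in>nbrs k. z l) \<le> nnbrs TYPE('d) * (\<Sum>l\<in>lball j (Suc R). z l)"
proof -
  have "(\<Sum>k\<in>lball j R. \<Sum>l\<in>nbrs k. z l) = (\<Sum>(k, l)\<in>Sigma (lball j R) nbrs. z l)"
    by (simp add: sum.Sigma finite_lball)
  also have "\<dots> \<le> (\<Sum>(k, l)\<in>prod.swap ` Sigma (lball j (Suc R)) nbrs. z l)"
  proof (rule sum_mono2)
    show "Sigma (lball j R) nbrs \<subseteq> prod.swap ` Sigma (lball j (Suc R)) nbrs"
      using lball_Suc_nbrs nbrs_sym by (fastforce simp: image_iff)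
  qed (auto simp: finite_lball assms)
  also have "\<dots> = (\<Sum>(l, k)\<in>Sigma (lball j (Suc R)) nbrs. z l)"
    by (subst sum.reindex) (auto simp: case_prod_beta intro!: inj_onI)
  also have "\<dots> = (\<Sum>l\<in>lball j (Suc R). \<Sum>k\<in>nbrs l. z l)"
    by (subst sum.Sigma) (auto simp: finite_lball)
  also have "\<dots> = nnbrs TYPE('d) * (\<Sum>l\<in>lball j (Suc R). z l)"
    by (simp add: card_nbrs sum_distrib_left)
  finally show ?thesis .
qed

text \<open>
  With \<open>L k = A * lw t k\<close>, the weight \<open>exp (- 3 * rnorm (k - j) + (t - \<tau>) * (L k + D))\<close> decreases in
  \<open>\<tau>\<close> fast enough to absorb the growth rate \<open>L k\<close>, unbounded in \<open>k\<close>, of \<open>v\<close>. As \<open>t * L k\<close> varies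
  by at most \<open>A\<close> between neighbours, \<open>D\<close> can be chosen to absorb the coupling, and the weighted sum
  of \<open>v\<close> is then nonincreasing up to boundary terms.
\<close>

lemma weighted_comparison:
  fixes v v' :: "real \<Rightarrow> int ^ 'd::finite \<Rightarrow> real"
  assumes "0 \<le> t" "0 \<le> A" "0 \<le> c" "0 \<le> K"
    and nonneg: "\<And>\<tau> k. 0 \<le> \<tau> \<Longrightarrow> \<tau> \<le> t \<Longrightarrow> 0 \<le> v \<tau> k"
    and deriv: "\<And>\<tau> k. 0 \<le> \<tau> \<Longrightarrow> \<tau> \<le> t \<Longrightarrow> ((\<lambda>\<tau>. v \<tau> k) has_real_derivative v' \<tau> k) (at \<tau>)"
    and deriv_le: "\<And>\<tau> k. 0 \<le> \<tau> \<Longrightarrow> \<tau> \<le> t \<Longrightarrow>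
      v' \<tau> k \<le> (A * lw t k + c) * v \<tau> k + K * (\<Sum>l\<in>nbrs k. v \<tau> l)"
    and growth: "\<And>\<tau> k. 0 \<le> \<tau> \<Longrightarrow> \<tau> \<le> t \<Longrightarrow> v \<tau> k \<le> B * (exp 1 + rnorm k)"
    and D: "D = c + K * nnbrs TYPE('d) * exp (3 + A)"
    and init: "\<And>F. finite F \<Longrightarrow>
      (\<Sum>k\<in>F. exp (- 3 * rnorm (k - j) + t * (A * lw t k + D)) * v 0 k) \<le> S"
  shows "v t j \<le> S"
proof -
  obtain S1 where S1: "1 \<le> S1"
    "\<And>(F :: (int ^ 'd) set) j. finite F \<Longrightarrow> (\<Sum>k\<in>F. exp (- rnorm (k - j))) \<le> S1"
    using sum_lattice_exp_le by blast
  define g where "g \<tau> k = - 3 * rnorm (k - j) + (t - \<tau>) * (A * lw t k + D)" for \<tau> and k :: "int ^ 'd"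
  define z where "z \<tau> k = exp (g \<tau> k) * v \<tau> k" for \<tau> k
  define q where "q = K * exp (3 + A)"
  have "0 \<le> D" "0 \<le> q"
    using assms(2-4) by (simp_all add: D q_def)
  have z_nonneg: "0 \<le> z \<tau> k" if "0 \<le> \<tau>" "\<tau> \<le> t" for \<tau> k
    using nonneg[OF that] by (simp add: z_def)
  have "0 \<le> B"
    using order_trans[OF nonneg growth, of 0 0] \<open>0 \<le> t\<close> by (simp add: zero_le_mult_iff)
  \<comment> \<open>Any constant independent of \<open>\<tau>\<close>, \<open>k\<close> and the
    radius would do, since \<open>M\<close> only multiplies a boundary term.\<close>
  define M where "M = B * exp ((t * A)\<^sup>2 + t * D) * (2 * exp (exp 1 + t + rnorm j))"
  have "0 \<le> M"
    using \<open>0 \<le> B\<close> by (simp add: M_def)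
  \<comment> \<open>Of the three units of decay in the weight, one absorbs the growth of
    \<open>v\<close> and of \<open>exp (t * (A * lw t k))\<close>, together the factor
    \<open>y\<^sup>2\<close>; one makes shells summable and one makes their sum vanish as the radius
    grows.\<close>
  have z_le: "z \<tau> k \<le> M * exp (- rnorm (k - j)) * exp (- rnorm (k - j))"
    if "0 \<le> \<tau>" "\<tau> \<le> t" for \<tau> k
  proof -
    define y where "y = exp 1 + t + rnorm k"
    have "0 \<le> y" "exp 1 + rnorm k \<le> y"
      using \<open>0 \<le> t\<close> by (auto simp: y_def intro!: add_nonneg_nonneg)
    have "0 \<le> A * lw t k + D"
      using \<open>0 \<le> A\<close> \<open>0 \<le> D\<close> lw_ge_1[OF \<open>0 \<le> t\<close>, of k] by simp
    then have "(t - \<tau>) * (A * lw t k + D) \<le> t * (A * lw t k + D)"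
      using that by (intro mult_right_mono) auto
    then have "exp (g \<tau> k) \<le> exp (- 3 * rnorm (k - j)) * (exp (t * (A * lw t k)) * exp (t * D))"
      by (simp add: g_def algebra_simps flip: exp_add)
    also have "\<dots> \<le> exp (- 3 * rnorm (k - j)) * (exp ((t * A)\<^sup>2) * y * exp (t * D))"
      unfolding y_def using \<open>0 \<le> t\<close> \<open>0 \<le> A\<close> by (intro mult_left_mono mult_right_mono exp_lw_le) auto
    finally have "z \<tau> k \<le> exp (- 3 * rnorm (k - j)) * (exp ((t * A)\<^sup>2) * y * exp (t * D)) * (B * y)"
      unfolding z_def using nonneg[OF that] growth[OF that, of k] \<open>0 \<le> B\<close> \<open>0 \<le> y\<close>
        \<open>exp 1 + rnorm k \<le> y\<close>
      by (intro mult_mono) (auto intro!: mult_nonneg_nonneg order_trans[OF growth[OF that]] mult_left_mono)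
    also have "\<dots> = exp (- 3 * rnorm (k - j)) * (B * exp ((t * A)\<^sup>2 + t * D)) * y\<^sup>2"
      by (simp add: exp_add power2_eq_square)
    also have "y\<^sup>2 \<le> 2 * exp (exp 1 + t + rnorm j) * exp (rnorm (k - j))"
    proof -
      have "y\<^sup>2 \<le> 2 * exp y"
        using power_le_fact_exp[OF \<open>0 \<le> y\<close>, of 2] by simp
      also have "exp y \<le> exp (exp 1 + t + rnorm j) * exp (rnorm (k - j))"
        using rnorm_triangle'[of k j] by (simp add: y_def flip: exp_add)
      finally show ?thesis by simp
    qed
    finally have "z \<tau> k \<le> exp (- 3 * rnorm (k - j)) * (B * exp ((t * A)\<^sup>2 + t * D))
        * (2 * exp (exp 1 + t + rnorm j) * exp (rnorm (k - j)))"
      using \<open>0 \<le> B\<close> by (simp add: mult_left_mono)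
    also have "\<dots> = M * (exp (- 3 * rnorm (k - j)) * exp (rnorm (k - j)))"
      by (simp add: M_def)
    also have "exp (- 3 * rnorm (k - j)) * exp (rnorm (k - j))
        = exp (- rnorm (k - j)) * exp (- rnorm (k - j))"
      by (simp flip: exp_add)
    finally show ?thesis
      by (simp add: mult.assoc)
  qed
  have Sz: "(\<Sum>k\<in>lball j R. z t k) \<le> S + t * (q * nnbrs TYPE('d) * (M * S1)) * exp (- real R)" for R
  proof -
    define Y where "Y \<tau> = (\<Sum>k\<in>lball j R. z \<tau> k)" for \<tau>
    define Y' where "Y' \<tau> = (\<Sum>k\<in>lball j R. exp (g \<tau> k) * (v' \<tau> k - (A * lw t k + D) * v \<tau> k))" for \<tau>
    define \<epsilon> where "\<epsilon> = q * nnbrs TYPE('d) * (M * S1) * exp (- real R)"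
    have Y_deriv: "(Y has_real_derivative Y' \<tau>) (at \<tau>)" if "0 \<le> \<tau>" "\<tau> \<le> t" for \<tau>
      unfolding Y_def[abs_def] Y'_def z_def g_def
      by (auto intro!: derivative_eq_intros deriv[OF that] simp: algebra_simps)
    have Y'_le: "Y' \<tau> \<le> \<epsilon>" if "0 \<le> \<tau>" "\<tau> \<le> t" for \<tau>
    proof -
      have "exp (g \<tau> k) * (v' \<tau> k - (A * lw t k + D) * v \<tau> k) \<le> (c - D) * z \<tau> k + q * (\<Sum>l\<in>nbrs k. z \<tau> l)" for k
      proof -
        \<comment> \<open>Passing to a neighbour changes the distance to \<open>j\<close> by at most
          one, hence its term in the exponent by at most 3, and raises the term with
          \<open>lw\<close> by at most \<open>A\<close>.\<close>
        have gk: "exp (g \<tau> k) \<le> exp (3 + A) * exp (g \<tau> l)" if "l \<in> nbrs k" for l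
        proof -
          have *: "t * (lw t k - lw t l) \<le> 1" "rnorm (l - j) \<le> rnorm (k - j) + 1"
            using lw_nbrs_diff[OF \<open>0 \<le> t\<close>, of k l] rnorm_nbrs_diff(1)[OF that, of j] that nbrs_sym by auto
          have "(t - \<tau>) * (A * (lw t k - lw t l)) \<le> A"
          proof (cases "lw t k \<le> lw t l")
            case True
            then have "(t - \<tau>) * (A * (lw t k - lw t l)) \<le> 0"
              using \<open>\<tau> \<le> t\<close> \<open>0 \<le> A\<close> by (intro mult_nonneg_nonpos) auto
            then show ?thesis using \<open>0 \<le> A\<close> by linarith
          next
            case False
            then have "(t - \<tau>) * (A * (lw t k - lw t l)) \<le> t * (A * (lw t k - lw t l))"
              using \<open>0 \<le> \<tau>\<close> \<open>0 \<le> A\<close> by (intro mult_right_mono) auto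
            also have "\<dots> = A * (t * (lw t k - lw t l))"
              by simp
            also have "\<dots> \<le> A * 1"
              using * \<open>0 \<le> A\<close> by (intro mult_left_mono) auto
            finally show ?thesis by simp
          qed
          then have "g \<tau> k \<le> (3 + A) + g \<tau> l"
            using * by (simp add: g_def algebra_simps)
          then show ?thesis
            by (simp flip: exp_add)
        qed
        have "exp (g \<tau> k) * (v' \<tau> k - (A * lw t k + D) * v \<tau> k)
            \<le> exp (g \<tau> k) * ((c - D) * v \<tau> k + K * (\<Sum>l\<in>nbrs k. v \<tau> l))"
          using deriv_le[OF that, of k] by (intro mult_left_mono) (auto simp: algebra_simps)
        also have "\<dots> = (c - D) * z \<tau> k + K * (\<Sum>l\<in>nbrs k. exp (g \<tau> k) * v \<tau> l)"
          by (simp add: z_def algebra_simps sum_distrib_left)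
        also have "K * (\<Sum>l\<in>nbrs k. exp (g \<tau> k) * v \<tau> l) \<le> K * (\<Sum>l\<in>nbrs k. exp (3 + A) * z \<tau> l)"
          using \<open>0 \<le> K\<close> gk nonneg[OF that] unfolding z_def mult.assoc[symmetric]
          by (intro mult_left_mono sum_mono mult_right_mono) auto
        also have "\<dots> = q * (\<Sum>l\<in>nbrs k. z \<tau> l)"
          by (simp add: q_def sum_distrib_left mult.assoc)
        finally show ?thesis by simp
      qed
      then have "Y' \<tau> \<le> (\<Sum>k\<in>lball j R. (c - D) * z \<tau> k + q * (\<Sum>l\<in>nbrs k. z \<tau> l))"
        unfolding Y'_def by (intro sum_mono)
      also have "\<dots> = (c - D) * Y \<tau> + q * (\<Sum>k\<in>lball j R. \<Sum>l\<in>nbrs k. z \<tau> l)"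
        by (simp add: Y_def sum.distrib sum_distrib_left)
      also have "(\<Sum>k\<in>lball j R. \<Sum>l\<in>nbrs k. z \<tau> l) \<le> nnbrs TYPE('d) * (\<Sum>l\<in>lball j (Suc R). z \<tau> l)"
        using z_nonneg[OF that] by (rule sum_nbrs_le)
      also have "(\<Sum>l\<in>lball j (Suc R). z \<tau> l) = Y \<tau> + (\<Sum>l\<in>lball j (Suc R) - lball j R. z \<tau> l)"
        unfolding Y_def by (subst sum.subset_diff[OF lball_mono finite_lball]) auto
      finally have "Y' \<tau> \<le> (c - D) * Y \<tau> + q * (nnbrs TYPE('d) * (Y \<tau> + (\<Sum>l\<in>lball j (Suc R) - lball j R. z \<tau> l)))"
        using \<open>0 \<le> q\<close> by (simp add: mult_left_mono)
      \<comment> \<open>The choice of \<open>D\<close> cancels \<open>Y \<tau>\<close>, because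
        \<open>c - D + q * nnbrs TYPE('d) = 0\<close>; only the outer shell is left.\<close>
      also have "\<dots> = q * nnbrs TYPE('d) * (\<Sum>l\<in>lball j (Suc R) - lball j R. z \<tau> l)"
        by (simp add: D q_def algebra_simps)
      also have "\<dots> \<le> q * nnbrs TYPE('d) * (\<Sum>l\<in>lball j (Suc R) - lball j R. M * exp (- real R) * exp (- rnorm (l - j)))"
      proof (intro mult_left_mono sum_mono)
        fix l assume "l \<in> lball j (Suc R) - lball j R"
        then have "real R \<le> rnorm (l - j)"
          by (simp add: lball_def rnorm_def)
        then have "M * exp (- rnorm (l - j)) * exp (- rnorm (l - j)) \<le> M * exp (- real R) * exp (- rnorm (l - j))"
          using \<open>0 \<le> M\<close> by (intro mult_left_mono mult_right_mono) auto
        then show "z \<tau> l \<le> M * exp (- real R) * exp (- rnorm (l - j))"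
          using z_le[OF that, of l] by linarith
      qed (use \<open>0 \<le> q\<close> in simp)
      also have "\<dots> = q * nnbrs TYPE('d) * (M * exp (- real R) * (\<Sum>l\<in>lball j (Suc R) - lball j R. exp (- rnorm (l - j))))"
        by (simp add: sum_distrib_left)
      also have "\<dots> \<le> q * nnbrs TYPE('d) * (M * exp (- real R) * S1)"
        using \<open>0 \<le> q\<close> \<open>0 \<le> M\<close> by (intro mult_left_mono S1) (auto simp: finite_lball)
      finally show ?thesis
        by (simp add: \<epsilon>_def mult_ac)
    qed
    have "Y t - \<epsilon> * t \<le> Y 0 - \<epsilon> * 0"
    proof (rule DERIV_nonpos_imp_nonincreasing[OF \<open>0 \<le> t\<close>])
      fix \<tau> assume "0 \<le> \<tau>" "\<tau> \<le> t"
      then have "((\<lambda>\<tau>. Y \<tau> - \<epsilon> * \<tau>) has_real_derivative Y' \<tau> - \<epsilon>) (at \<tau>)"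
        by (auto intro!: derivative_eq_intros Y_deriv)
      then show "\<exists>y. ((\<lambda>\<tau>. Y \<tau> - \<epsilon> * \<tau>) has_real_derivative y) (at \<tau>) \<and> y \<le> 0"
        using Y'_le[OF \<open>0 \<le> \<tau>\<close> \<open>\<tau> \<le> t\<close>] by (intro exI[of _ "Y' \<tau> - \<epsilon>"]) simp
    qed
    moreover have "Y 0 \<le> S"
      unfolding Y_def z_def g_def using init[OF finite_lball] by simp
    ultimately show ?thesis
      by (simp add: Y_def \<epsilon>_def mult_ac)
  qed
  \<comment> \<open>At \<open>\<tau> = t\<close> the weight at \<open>k = j\<close> is 1, so a
    single term of the ball sum is \<open>v t j\<close> itself; afterwards the radius tends to
    infinity.\<close>
  have "v t j \<le> S + t * (q * nnbrs TYPE('d) * (M * S1)) * exp (- real R)" for R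
  proof -
    have "v t j = z t j"
      by (simp add: z_def g_def)
    also have "\<dots> \<le> (\<Sum>k\<in>lball j R. z t k)"
      using z_nonneg \<open>0 \<le> t\<close> by (intro member_le_sum) (auto simp: finite_lball self_in_lball)
    finally show ?thesis
      using Sz[of R] by linarith
  qed
  moreover have "(\<lambda>R. S + C * exp (- real R)) \<longlonglongrightarrow> S + C * 0" for C
  proof (intro tendsto_intros)
    show "(\<lambda>R. exp (- real R)) \<longlonglongrightarrow> 0"
      by (rule filterlim_compose[OF exp_at_bot])
        (simp add: filterlim_uminus_at_bot filterlim_real_sequentially)
  qed
  ultimately show ?thesis
    by (intro LIMSEQ_le_const[where X = "\<lambda>R. S + t * (q * nnbrs TYPE('d) * (M * S1)) * exp (- real R)"]) auto
qed

section \<open>Quartic polynomials\<close>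

lemma poly_degree_4:
  fixes P :: "real poly"
  assumes "degree P = 4"
  shows "poly P x = coeff P 0 + coeff P 1 * x + coeff P 2 * x ^ 2 + coeff P 3 * x ^ 3 + lead_coeff P * x ^ 4"
    and "poly (pderiv P) x = coeff P 1 + 2 * coeff P 2 * x + 3 * coeff P 3 * x ^ 2 + 4 * lead_coeff P * x ^ 3"
  by (simp_all add: poly_altdef degree_pderiv assms coeff_pderiv eval_nat_numeral)

lemma power_le_1_plus_power4: "k \<le> 4 \<Longrightarrow> \<bar>x :: real\<bar> ^ k \<le> 1 + x ^ 4"
proof (cases "\<bar>x\<bar> \<le> 1")
  case True
  then have "\<bar>x\<bar> ^ k \<le> 1"
    by (simp add: power_le_one)
  moreover have "0 \<le> x ^ 4"
    by simp
  ultimately show ?thesis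
    by linarith
next
  case False
  assume "k \<le> 4"
  then have "\<bar>x\<bar> ^ k \<le> \<bar>x\<bar> ^ 4"
    using False by (intro power_increasing) auto
  then show ?thesis
    by (simp add: power_even_abs_numeral)
qed

lemma quartic_lower_bound:
  fixes P :: "real poly"
  assumes "degree P = 4" "lead_coeff P > 0" "\<forall>s. poly P s \<ge> 0"
  shows "\<exists>C\<ge>1. \<forall>q. q ^ 4 \<le> C * (poly P q + 1)"
proof -
  define a where "a = lead_coeff P"
  define b where "b = \<bar>coeff P 0\<bar> + \<bar>coeff P 1\<bar> + \<bar>coeff P 2\<bar> + \<bar>coeff P 3\<bar>"
  \<comment> \<open>Beyond \<open>R\<close> the bound \<open>b * |q| ^ 3\<close> on the lower terms
    is at most half of \<open>a * q ^ 4\<close>; within \<open>R\<close>, \<open>q ^ 4\<close> is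
    bounded and \<open>poly P q + 1 \<ge> 1\<close>.\<close>
  define R where "R = 1 + 2 * b / a"
  have "0 < a" "0 \<le> b" "1 \<le> R"
    using assms(2) by (auto simp: a_def b_def R_def)
  have "q ^ 4 \<le> (R ^ 4 + 2 / a) * (poly P q + 1)" for q
  proof (cases "\<bar>q\<bar> \<le> R")
    case True
    then have "q ^ 4 \<le> R ^ 4"
      using power_mono[of "\<bar>q\<bar>" R 4] by (simp add: power_even_abs_numeral)
    also have "\<dots> \<le> (R ^ 4 + 2 / a) * (poly P q + 1)"
      using mult_mono[of "R ^ 4" "R ^ 4 + 2 / a" 1 "poly P q + 1"] assms(3) \<open>0 < a\<close> \<open>1 \<le> R\<close> by simp
    finally show ?thesis .
  next
    case False
    then have "1 \<le> \<bar>q\<bar>"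
      using \<open>1 \<le> R\<close> by linarith
    moreover have "2 * b \<le> a * \<bar>q\<bar>"
      using False \<open>0 < a\<close> by (simp add: R_def field_simps)
    ultimately have q: "1 \<le> \<bar>q\<bar>" "2 * b \<le> a * \<bar>q\<bar>"
      by simp_all
    have cq: "- (\<bar>c\<bar> * \<bar>q\<bar> ^ 3) \<le> c * q ^ k" if "k \<le> 3" for c k
    proof -
      have "\<bar>c * q ^ k\<bar> \<le> \<bar>c\<bar> * \<bar>q\<bar> ^ 3"
        using q that by (auto simp: abs_mult power_abs intro!: mult_left_mono power_increasing)
      then show ?thesis by linarith
    qed
    have "a * q ^ 4 - b * \<bar>q\<bar> ^ 3 \<le> poly P q"
      using cq[of 0 "coeff P 0"] cq[of 1 "coeff P 1"] cq[of 2 "coeff P 2"] cq[of 3 "coeff P 3"]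
      unfolding poly_degree_4(1)[OF assms(1)] a_def b_def by (simp add: algebra_simps)
    moreover have "2 * b * \<bar>q\<bar> ^ 3 \<le> (a * \<bar>q\<bar>) * \<bar>q\<bar> ^ 3"
      using q by (intro mult_right_mono) auto
    moreover have "(a * \<bar>q\<bar>) * \<bar>q\<bar> ^ 3 = a * q ^ 4"
      using power_even_abs_numeral[of "num.Bit0 (num.Bit0 num.One)" q] by (simp add: eval_nat_numeral)
    ultimately have "a * q ^ 4 \<le> 2 * poly P q"
      by linarith
    then have "q ^ 4 \<le> 2 / a * poly P q"
      using \<open>0 < a\<close> by (simp add: field_simps)
    also have "\<dots> \<le> (R ^ 4 + 2 / a) * (poly P q + 1)"
      using assms(3) \<open>0 < a\<close> by (intro mult_mono) auto
    finally show ?thesis .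
  qed
  moreover have "1 \<le> R ^ 4 + 2 / a"
    using \<open>1 \<le> R\<close> \<open>0 < a\<close> one_le_power[of R 4] by (simp add: add_increasing2)
  ultimately show ?thesis
    by blast
qed

text \<open>The difference quotient of the cubic \<open>pderiv P\<close> is an explicit quadratic
  polynomial in \<open>x\<close> and \<open>y\<close>. Through it a bound on
  \<open>q\<^sup>2\<close> becomes a growth rate for differences of orbits.\<close>

lemma quartic_deriv_lipschitz:
  fixes P :: "real poly"
  assumes "degree P = 4"
  shows "\<exists>C\<ge>0. \<forall>x y. \<bar>poly (pderiv P) x - poly (pderiv P) y\<bar> \<le> C * (1 + x\<^sup>2 + y\<^sup>2) * \<bar>x - y\<bar>"
proof -
  define C where "C = 2 * \<bar>coeff P 2\<bar> + 3 * \<bar>coeff P 3\<bar> + 8 * \<bar>lead_coeff P\<bar>"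
  have "\<bar>poly (pderiv P) x - poly (pderiv P) y\<bar> \<le> C * (1 + x\<^sup>2 + y\<^sup>2) * \<bar>x - y\<bar>" for x y
  proof -
    define m where "m = 1 + x\<^sup>2 + y\<^sup>2"
    have "poly (pderiv P) x - poly (pderiv P) y
        = (2 * coeff P 2 + 3 * coeff P 3 * (x + y) + 4 * lead_coeff P * (x\<^sup>2 + x * y + y\<^sup>2)) * (x - y)"
      unfolding poly_degree_4(2)[OF assms] by (simp add: algebra_simps power2_eq_square power3_eq_cube)
    moreover have "\<bar>2 * coeff P 2 + 3 * coeff P 3 * (x + y) + 4 * lead_coeff P * (x\<^sup>2 + x * y + y\<^sup>2)\<bar> \<le> C * m"
    proof -
      have "2 * \<bar>x\<bar> \<le> 1 + x\<^sup>2" "2 * \<bar>y\<bar> \<le> 1 + y\<^sup>2" "0 \<le> x\<^sup>2" "0 \<le> y\<^sup>2"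
        using zero_le_power2[of "\<bar>x\<bar> - 1"] zero_le_power2[of "\<bar>y\<bar> - 1"] by (auto simp: power2_diff)
      then have "\<bar>x + y\<bar> \<le> m"
        unfolding m_def by linarith
      moreover have "\<bar>x\<^sup>2 + x * y + y\<^sup>2\<bar> \<le> 2 * m"
      proof -
        have "2 * (x * y) \<le> x\<^sup>2 + y\<^sup>2" "2 * - (x * y) \<le> x\<^sup>2 + y\<^sup>2"
          using sum_squares_bound[of x y] sum_squares_bound[of x "- y"] by simp_all
        moreover have "\<bar>u + v + w\<bar> \<le> 2 * (1 + u + w)"
          if "2 * v \<le> u + w" "2 * - v \<le> u + w" "0 \<le> u" "0 \<le> w" for u v w :: real
          using that by (intro abs_leI) simp_all
        ultimately show ?thesis
          unfolding m_def by simp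
      qed
      moreover have "1 \<le> m"
        by (simp add: m_def)
      ultimately have *: "\<bar>2 * coeff P 2\<bar> \<le> 2 * \<bar>coeff P 2\<bar> * m"
        "\<bar>3 * coeff P 3 * (x + y)\<bar> \<le> 3 * \<bar>coeff P 3\<bar> * m"
        "\<bar>4 * lead_coeff P * (x\<^sup>2 + x * y + y\<^sup>2)\<bar> \<le> 4 * \<bar>lead_coeff P\<bar> * (2 * m)"
        unfolding abs_mult by (simp add: mult_le_cancel_left1, (intro mult_mono; simp)+)
      have **: "\<bar>u + v + w\<bar> \<le> u' + v' + w'" if "\<bar>u\<bar> \<le> u'" "\<bar>v\<bar> \<le> v'" "\<bar>w\<bar> \<le> w'"
        for u v w u' v' w' :: real
        using that by linarith
      show ?thesis
        by (rule order_trans[OF **[OF *]]) (simp add: C_def algebra_simps)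
    qed
    ultimately show ?thesis
      by (simp add: m_def abs_mult mult_right_mono)
  qed
  moreover have "0 \<le> C"
    by (simp add: C_def)
  ultimately show ?thesis
    by blast
qed

lemma quartic_deriv_bound:
  fixes P :: "real poly"
  assumes "degree P = 4"
  shows "\<exists>C\<ge>0. \<forall>q. \<bar>poly (pderiv P) q\<bar> \<le> C * (1 + q ^ 4)"
proof -
  define C where "C = \<bar>coeff P 1\<bar> + 2 * \<bar>coeff P 2\<bar> + 3 * \<bar>coeff P 3\<bar> + 4 * \<bar>lead_coeff P\<bar>"
  have "\<bar>poly (pderiv P) q\<bar> \<le> C * (1 + q ^ 4)" for q
  proof -
    have *: "\<bar>c * q ^ k\<bar> \<le> \<bar>c\<bar> * (1 + q ^ 4)" if "k \<le> 4" for c k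
      using power_le_1_plus_power4[OF that] by (simp add: abs_mult power_abs mult_left_mono)
    have **: "\<bar>u + v + w + x\<bar> \<le> u' + v' + w' + x'"
      if "\<bar>u\<bar> \<le> u'" "\<bar>v\<bar> \<le> v'" "\<bar>w\<bar> \<le> w'" "\<bar>x\<bar> \<le> x'" for u v w x u' v' w' x' :: real
      using that by linarith
    have "\<bar>poly (pderiv P) q\<bar> = \<bar>coeff P 1 * q ^ 0 + 2 * coeff P 2 * q ^ 1
        + 3 * coeff P 3 * q ^ 2 + 4 * lead_coeff P * q ^ 3\<bar>"
      unfolding poly_degree_4(2)[OF assms] by simp
    also have "\<dots> \<le> \<bar>coeff P 1\<bar> * (1 + q ^ 4) + \<bar>2 * coeff P 2\<bar> * (1 + q ^ 4)
        + \<bar>3 * coeff P 3\<bar> * (1 + q ^ 4) + \<bar>4 * lead_coeff P\<bar> * (1 + q ^ 4)"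
      by (intro ** *) auto
    also have "\<dots> = C * (1 + q ^ 4)"
      by (simp add: C_def abs_mult algebra_simps)
    finally show ?thesis .
  qed
  moreover have "0 \<le> C"
    by (simp add: C_def)
  ultimately show ?thesis
    by blast
qed

section \<open>Local energies\<close>

locale quartic_lattice =
  fixes P :: "real poly" and K :: real and \<Phi> :: "real \<Rightarrow> 'd::finite cfg \<Rightarrow> 'd cfg"
  assumes K_pos: "K > 0"
    and degree_P: "degree P = 4" and lead_coeff_P: "lead_coeff P > 0" and P_nonneg: "\<forall>s. poly P s \<ge> 0"
    and flow: "is_flow (poly P) (poly (pderiv P)) K \<Phi>"
begin

abbreviation phase_space :: "'d cfg set" where "phase_space \<equiv> X0 (poly P) K"

lemma flow_phase_space: "x \<in> phase_space \<Longrightarrow> \<Phi> t x \<in> phase_space"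
  and flow_0: "x \<in> phase_space \<Longrightarrow> \<Phi> 0 x = x"
  and flow_add: "x \<in> phase_space \<Longrightarrow> \<Phi> (s + t) x = \<Phi> s (\<Phi> t x)"
  and flow_q: "x \<in> phase_space \<Longrightarrow> ((\<lambda>t. fst (\<Phi> t x k)) has_real_derivative snd (\<Phi> t x k)) (at t)"
  and flow_p: "x \<in> phase_space \<Longrightarrow>
    ((\<lambda>t. snd (\<Phi> t x k)) has_real_derivative force (poly (pderiv P)) K (\<Phi> t x) k) (at t)"
  and flow_Q: "x \<in> phase_space \<Longrightarrow> \<exists>B. \<forall>t. \<bar>t\<bar> \<le> T \<longrightarrow> Qfun (poly P) K (\<Phi> t x) \<le> ereal B"
  using flow unfolding is_flow_def by blast+

lemma force_eq:
  "force (poly (pderiv P)) K x k = - poly (pderiv P) (fst (x k)) - K * (\<Sum>l\<in>nbrs k. fst (x k) - fst (x l))"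
  by (simp add: force_def nbrs_def)

definition site_en :: "'d cfg \<Rightarrow> int ^ 'd \<Rightarrow> real" where
  "site_en x k = (snd (x k))\<^sup>2 / 2 + poly P (fst (x k)) + 1"

text \<open>The bond energy \<open>K / 2 * (q_k - q_l)\<^sup>2\<close> is shared equally between its
  two ends, so that energy moves between neighbours by antisymmetric currents.\<close>

definition loc_en :: "'d cfg \<Rightarrow> int ^ 'd \<Rightarrow> real" where
  "loc_en x k = site_en x k + K / 4 * (\<Sum>l\<in>nbrs k. (fst (x k) - fst (x l))\<^sup>2)"

lemma site_en_ge_1: "1 \<le> site_en x k"
  using P_nonneg by (simp add: site_en_def)

lemma p_sq_le: "(snd (x k))\<^sup>2 \<le> 2 * site_en x k"
  using P_nonneg[rule_format, of "fst (x k)"] by (simp add: site_en_def)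

lemma site_en_le_loc_en: "site_en x k \<le> loc_en x k"
  using K_pos by (simp add: loc_en_def sum_nonneg)

lemma q_pow4_le: "\<exists>C\<ge>1. \<forall>x k. fst (x k) ^ 4 \<le> C * site_en x k"
proof -
  obtain C where C: "1 \<le> C" "\<And>q. q ^ 4 \<le> C * (poly P q + 1)"
    using quartic_lower_bound[OF degree_P lead_coeff_P P_nonneg] by blast
  have "C * (poly P (fst (x k)) + 1) \<le> C * site_en x k" for x :: "'d cfg" and k
    using \<open>1 \<le> C\<close> by (intro mult_left_mono) (auto simp: site_en_def)
  then have "fst (x k) ^ 4 \<le> C * site_en x k" for x :: "'d cfg" and k
    using C(2)[of "fst (x k)"] order_trans by blast
  then show ?thesis
    using C(1) by blast
qed

lemma q_sq_le: "\<exists>C\<ge>1. \<forall>x k. (fst (x k))\<^sup>2 \<le> C * site_en x k"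
proof -
  obtain C where C: "1 \<le> C" "\<And>(x :: 'd cfg) k. fst (x k) ^ 4 \<le> C * site_en x k"
    using q_pow4_le by blast
  have "(fst (x k))\<^sup>2 \<le> (1 + C) * site_en x k" for x :: "'d cfg" and k
  proof -
    have "(fst (x k))\<^sup>2 \<le> 1 + fst (x k) ^ 4"
      using power_le_1_plus_power4[of 2 "fst (x k)"] by simp
    also have "\<dots> \<le> (1 + C) * site_en x k"
      using C(2)[of x k] site_en_ge_1[of x k] by (simp add: algebra_simps)
    finally show ?thesis .
  qed
  then show ?thesis
    using C(1) by (intro exI[of _ "1 + C"]) auto
qed

text \<open>The square root enters here: the potential controls \<open>q ^ 4\<close>, so a
  logarithmic energy leaves \<open>q\<^sup>2\<close> of the order of the square root of the
  logarithm.\<close>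

lemma q_sq_le_lw: "\<exists>C\<ge>0. \<forall>x k B t. 0 \<le> t \<longrightarrow> site_en x k \<le> B * lnw t k \<longrightarrow> (fst (x k))\<^sup>2 \<le> C * sqrt B * lw t k"
proof -
  obtain C where C: "1 \<le> C" "\<And>(x :: 'd cfg) k. fst (x k) ^ 4 \<le> C * site_en x k"
    using q_pow4_le by blast
  have "(fst (x k))\<^sup>2 \<le> sqrt C * sqrt B * lw t k"
    if "0 \<le> t" "site_en x k \<le> B * lnw t k" for x k B t
  proof -
    have "((fst (x k))\<^sup>2)\<^sup>2 \<le> C * (B * lnw t k)"
      using C(2)[of x k] that(2) \<open>1 \<le> C\<close> by (simp add: order_trans[OF _ mult_left_mono])
    then have "(fst (x k))\<^sup>2 \<le> sqrt (C * (B * lnw t k))"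
      by (rule real_le_rsqrt)
    then show ?thesis
      by (simp add: real_sqrt_mult lw_def mult.assoc)
  qed
  then show ?thesis
    using C(1) by (intro exI[of _ "sqrt C"]) auto
qed

lemma loc_en_le: "\<exists>C\<ge>1. \<forall>x k. loc_en x k \<le> C * (site_en x k + (\<Sum>l\<in>nbrs k. site_en x l))"
proof -
  obtain C where C: "1 \<le> C" "\<And>(x :: 'd cfg) k. (fst (x k))\<^sup>2 \<le> C * site_en x k"
    using q_sq_le by blast
  define c where "c = 1 + K / 2 * C * (nnbrs TYPE('d) + 1)"
  have "1 \<le> c"
    using C(1) K_pos by (simp add: c_def add_nonneg_nonneg)
  have "loc_en x k \<le> c * (site_en x k + (\<Sum>l\<in>nbrs k. site_en x l))" for x :: "'d cfg" and k
  proof -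
    have *: "(fst (x k) - fst (x l))\<^sup>2 \<le> 2 * C * (site_en x k + site_en x l)" for l
    proof -
      have "(fst (x k) - fst (x l))\<^sup>2 \<le> 2 * (fst (x k))\<^sup>2 + 2 * (fst (x l))\<^sup>2"
        using zero_le_power2[of "fst (x k) + fst (x l)"] by (simp add: power2_diff power2_sum)
      then show ?thesis
        using C(2)[of x k] C(2)[of x l] by (simp add: algebra_simps)
    qed
    have "(\<Sum>l\<in>nbrs k. (fst (x k) - fst (x l))\<^sup>2) \<le> (\<Sum>l\<in>nbrs k. 2 * C * (site_en x k + site_en x l))"
      by (intro sum_mono *)
    also have "\<dots> = 2 * C * (nnbrs TYPE('d) * site_en x k + (\<Sum>l\<in>nbrs k. site_en x l))"
      by (simp add: sum.distrib card_nbrs flip: sum_distrib_left)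
    finally have "K / 4 * (\<Sum>l\<in>nbrs k. (fst (x k) - fst (x l))\<^sup>2)
        \<le> K / 4 * (2 * C * (nnbrs TYPE('d) * site_en x k + (\<Sum>l\<in>nbrs k. site_en x l)))"
      using K_pos by (intro mult_left_mono) auto
    then have "loc_en x k \<le> site_en x k + K / 4 * (2 * C * (nnbrs TYPE('d) * site_en x k + (\<Sum>l\<in>nbrs k. site_en x l)))"
      by (simp add: loc_en_def)
    also have "\<dots> = (1 + K / 2 * C * nnbrs TYPE('d)) * site_en x k + K / 2 * C * (\<Sum>l\<in>nbrs k. site_en x l)"
      by (simp add: algebra_simps)
    also have "\<dots> \<le> c * site_en x k + c * (\<Sum>l\<in>nbrs k. site_en x l)"
    proof (intro add_mono mult_right_mono)
      show "1 + K / 2 * C * nnbrs TYPE('d) \<le> c" "K / 2 * C \<le> c"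
        using C(1) K_pos mult_nonneg_nonneg[of "K / 2 * C" "nnbrs TYPE('d)"]
        unfolding c_def distrib_left by simp_all
    qed (auto intro!: sum_nonneg order_trans[OF _ site_en_ge_1])
    finally show ?thesis
      by (simp add: algebra_simps)
  qed
  then show ?thesis
    using \<open>1 \<le> c\<close> by blast
qed

lemma site_en_le_Wloc: "site_en x \<nu> \<le> Wloc (poly P) K \<nu> n x"
proof -
  have "site_en x \<nu> \<le> (\<Sum>i\<in>cube \<nu> n. site_en x i)"
    by (intro member_le_sum finite_cube order_trans[OF _ site_en_ge_1]) (auto simp: cube_def)
  moreover have "0 \<le> (\<Sum>(i, j)\<in>{(i, j). i \<in> cube \<nu> n \<and> j \<in> cube \<nu> n \<and> ldist j i = 1}.
        K / 4 * (fst (x i) - fst (x j))\<^sup>2)"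
    using K_pos by (intro sum_nonneg) auto
  ultimately show ?thesis
    by (simp add: Wloc_def site_en_def)
qed

text \<open>The energy of a site is part of \<open>Wloc\<close> on the smallest admissible cube
  around it. That cube has volume of order \<open>ln (e + |\<nu>|)\<close>, so finiteness of
  \<open>Qfun\<close> gives logarithmic growth of energies.\<close>

lemma site_en_le_Qfun:
  assumes "Qfun (poly P) K x \<le> ereal B"
  shows "site_en x \<nu> \<le> 5 ^ CARD('d) * B * lnw 0 \<nu>"
proof -
  define L where "L = ln (exp 1 + rnorm \<nu>) powr (1 / real CARD('d))"
  \<comment> \<open>The least integer strictly above \<open>L\<close>, as the supremum demands;
    \<open>L \<ge> 1\<close> then gives \<open>2 * n + 1 \<le> 5 * L\<close>, the origin of
    \<open>5 ^ CARD('d)\<close>.\<close>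
  define n where "n = nat \<lfloor>L\<rfloor> + 1"
  have "1 \<le> ln (exp 1 + rnorm \<nu>)"
    using lnw_ge_1[of 0 \<nu>] by simp
  then have "1 \<le> L"
    by (simp add: L_def ge_one_powr_ge_zero)
  have "L < real n" "real n \<le> L + 1"
    using \<open>1 \<le> L\<close> by (simp_all add: n_def) linarith+
  then have "ereal (Wloc (poly P) K (fst (\<nu>, n)) (snd (\<nu>, n)) x / (2 * real (snd (\<nu>, n)) + 1) ^ CARD('d)) \<le> Qfun (poly P) K x"
    unfolding Qfun_def by (intro SUP_upper) (simp add: L_def rnorm_def)
  then have "ereal (Wloc (poly P) K \<nu> n x / (2 * real n + 1) ^ CARD('d)) \<le> Qfun (poly P) K x"
    by simp
  then have "ereal (Wloc (poly P) K \<nu> n x / (2 * real n + 1) ^ CARD('d)) \<le> ereal B"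
    using assms by (rule order_trans)
  then have W: "Wloc (poly P) K \<nu> n x \<le> B * (2 * real n + 1) ^ CARD('d)"
    by (simp add: divide_le_eq add_pos_nonneg)
  have "0 < Wloc (poly P) K \<nu> n x"
    using site_en_le_Wloc[of x \<nu> n] site_en_ge_1[of x \<nu>] by linarith
  then have "0 < B"
    using W by (smt (verit) mult_nonpos_nonneg zero_le_power of_nat_0_le_iff)
  have "site_en x \<nu> \<le> B * (2 * real n + 1) ^ CARD('d)"
    using W site_en_le_Wloc[of x \<nu> n] by linarith
  also have "\<dots> \<le> B * (5 * L) ^ CARD('d)"
    using \<open>0 < B\<close> \<open>real n \<le> L + 1\<close> \<open>1 \<le> L\<close> by (intro mult_left_mono power_mono) auto
  also have "\<dots> = 5 ^ CARD('d) * B * L ^ CARD('d)"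
    by (simp add: power_mult_distrib)
  also have "L ^ CARD('d) = ln (exp 1 + rnorm \<nu>)"
    using \<open>1 \<le> ln (exp 1 + rnorm \<nu>)\<close> by (simp add: L_def powr_power)
  finally show ?thesis
    by simp
qed

text \<open>The constant depends on \<open>x\<close> and \<open>T\<close> in an uncontrolled way,
  which is enough for the growth hypothesis of \<open>weighted_comparison\<close>.\<close>

lemma flow_site_en_growth:
  assumes "x \<in> phase_space"
  shows "\<exists>B\<ge>0. \<forall>\<tau> k. \<bar>\<tau>\<bar> \<le> T \<longrightarrow> site_en (\<Phi> \<tau> x) k \<le> B * lnw 0 k"
proof (cases "0 \<le> T")
  case True
  obtain B where B: "\<And>t. \<bar>t\<bar> \<le> T \<Longrightarrow> Qfun (poly P) K (\<Phi> t x) \<le> ereal B"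
    using flow_Q[OF assms] by blast
  have *: "site_en (\<Phi> \<tau> x) k \<le> 5 ^ CARD('d) * B * lnw 0 k" if "\<bar>\<tau>\<bar> \<le> T" for \<tau> k
    using site_en_le_Qfun[OF B[OF that]] .
  have "0 < 5 ^ CARD('d) * B * lnw 0 (0 :: int ^ 'd)"
    using *[of 0 0] True site_en_ge_1[of "\<Phi> 0 x" 0] by linarith
  then have "0 \<le> 5 ^ CARD('d) * B"
    using lnw_ge_1[of 0 "0 :: int ^ 'd"] by (simp add: zero_less_mult_iff)
  then show ?thesis
    using * by blast
next
  case False
  then show ?thesis
    by (intro exI[of _ 0]) auto
qed

text \<open>Only finitely many terms of \<open>Wloc\<close> involve site \<open>i\<close>, and the
  normalising volumes are at least 1, so \<open>Qfun\<close> grows by a bounded amount. Derivatives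
  of the flow in \<open>x i\<close> thus compare orbits to which all estimates apply.\<close>

lemma phase_space_upd:
  assumes "x \<in> phase_space"
  shows "x(i := z) \<in> phase_space"
proof -
  define y where "y = x(i := z)"
  define b where "b = \<bar>site_en y i - site_en x i\<bar>"
  define H where "H w p = K / 4 * (fst (w (fst p)) - fst (w (snd p)))\<^sup>2" for w :: "'d cfg" and p
  define Pi where "Pi = {i} \<times> nbrs i \<union> nbrs i \<times> {i}"
  define b' where "b' = (\<Sum>p\<in>Pi. \<bar>H y p - H x p\<bar>)"
  have W: "Wloc (poly P) K \<nu> n y \<le> Wloc (poly P) K \<nu> n x + (b + b')" for \<nu> n
  proof -
    let ?S = "{(i, j). i \<in> cube \<nu> n \<and> j \<in> cube \<nu> n \<and> ldist j i = 1}"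
    have fS: "finite ?S"
      by (rule finite_subset[of _ "cube \<nu> n \<times> cube \<nu> n"]) (auto simp: finite_cube)
    have "(\<Sum>k\<in>cube \<nu> n. site_en y k) - (\<Sum>k\<in>cube \<nu> n. site_en x k)
        \<le> (\<Sum>k\<in>cube \<nu> n. if k = i then b else 0)"
      unfolding sum_subtractf[symmetric] by (intro sum_mono) (auto simp: b_def y_def site_en_def)
    also have "\<dots> \<le> b"
      by (simp add: finite_cube b_def)
    finally have 1: "(\<Sum>k\<in>cube \<nu> n. site_en y k) \<le> (\<Sum>k\<in>cube \<nu> n. site_en x k) + b"
      by simp
    have "(\<Sum>p\<in>?S. H y p) - (\<Sum>p\<in>?S. H x p) = (\<Sum>p\<in>?S \<inter> Pi. H y p - H x p)"
      unfolding sum_subtractf[symmetric]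
    proof (rule sum.mono_neutral_right[OF fS])
      show "\<forall>p\<in>?S - ?S \<inter> Pi. H y p - H x p = 0"
        by (auto simp: Pi_def H_def y_def nbrs_def ldist_def lnorm_minus_commute)
    qed auto
    also have "\<dots> \<le> (\<Sum>p\<in>?S \<inter> Pi. \<bar>H y p - H x p\<bar>)"
      by (intro sum_mono) auto
    also have "\<dots> \<le> b'"
      unfolding b'_def by (intro sum_mono2) (auto simp: Pi_def)
    finally have 2: "(\<Sum>p\<in>?S. H y p) \<le> (\<Sum>p\<in>?S. H x p) + b'"
      by simp
    show ?thesis
      using 1 2 unfolding Wloc_def site_en_def[symmetric] H_def case_prod_beta by linarith
  qed
  have "0 \<le> b" "0 \<le> b'"
    by (simp_all add: b_def b'_def sum_nonneg)
  have "Qfun (poly P) K y \<le> Qfun (poly P) K x + ereal (b + b')"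
    unfolding Qfun_def[of _ _ y]
  proof (rule SUP_least)
    fix p :: "(int ^ 'd) \<times> nat"
    assume p: "p \<in> {(\<nu>, k). real k > ln (exp 1 + real_of_int (lnorm \<nu>)) powr (1 / real CARD('d))}"
    have D1: "1 \<le> (2 * real (snd p) + 1) ^ CARD('d)"
      by (intro one_le_power) auto
    have "Wloc (poly P) K (fst p) (snd p) y / (2 * real (snd p) + 1) ^ CARD('d)
        \<le> (Wloc (poly P) K (fst p) (snd p) x + (b + b')) / (2 * real (snd p) + 1) ^ CARD('d)"
      using W D1 by (intro divide_right_mono) auto
    also have "\<dots> \<le> Wloc (poly P) K (fst p) (snd p) x / (2 * real (snd p) + 1) ^ CARD('d) + (b + b')"
      using D1 \<open>0 \<le> b\<close> \<open>0 \<le> b'\<close> divide_left_mono[of 1 "(2 * real (snd p) + 1) ^ CARD('d)" "b + b'"]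
      by (simp add: add_divide_distrib)
    finally have "ereal (Wloc (poly P) K (fst p) (snd p) y / (2 * real (snd p) + 1) ^ CARD('d))
        \<le> ereal (Wloc (poly P) K (fst p) (snd p) x / (2 * real (snd p) + 1) ^ CARD('d)) + ereal (b + b')"
      by simp
    also have "\<dots> \<le> Qfun (poly P) K x + ereal (b + b')"
      unfolding Qfun_def by (intro add_right_mono SUP_upper p)
    finally show "ereal (Wloc (poly P) K (fst p) (snd p) y / (2 * real (snd p) + 1) ^ CARD('d))
        \<le> Qfun (poly P) K x + ereal (b + b')" .
  qed
  also have "\<dots> < \<infinity>"
    using assms by (simp add: X0_def)
  finally show ?thesis
    by (simp add: X0_def y_def)
qed

end

section \<open>Propagation of energy and of perturbations\<close>

context quartic_lattice
begin

text \<open>The terms with \<open>pderiv P\<close> cancel; what remains is a sum of currents,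
  antisymmetric under exchange of \<open>k\<close> and \<open>l\<close> and free of the
  potential.\<close>

lemma loc_en_deriv:
  assumes "x \<in> phase_space"
  shows "((\<lambda>t. loc_en (\<Phi> t x) k) has_real_derivative
    - (K / 2) * (\<Sum>l\<in>nbrs k. (fst (\<Phi> t x k) - fst (\<Phi> t x l)) * (snd (\<Phi> t x k) + snd (\<Phi> t x l)))) (at t)"
proof -
  have "((\<lambda>t. loc_en (\<Phi> t x) k) has_real_derivative
      snd (\<Phi> t x k) * force (poly (pderiv P)) K (\<Phi> t x) k + poly (pderiv P) (fst (\<Phi> t x k)) * snd (\<Phi> t x k)
      + K / 4 * (\<Sum>l\<in>nbrs k. 2 * (fst (\<Phi> t x k) - fst (\<Phi> t x l)) * (snd (\<Phi> t x k) - snd (\<Phi> t x l)))) (at t)"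
    unfolding loc_en_def site_en_def
    by (auto intro!: derivative_eq_intros flow_q[OF assms] flow_p[OF assms] DERIV_chain2[OF poly_DERIV] sum.cong
        simp: mult_ac)
  moreover have "snd (\<Phi> t x k) * force (poly (pderiv P)) K (\<Phi> t x) k + poly (pderiv P) (fst (\<Phi> t x k)) * snd (\<Phi> t x k)
      + K / 4 * (\<Sum>l\<in>nbrs k. 2 * (fst (\<Phi> t x k) - fst (\<Phi> t x l)) * (snd (\<Phi> t x k) - snd (\<Phi> t x l)))
      = - (K / 2) * (\<Sum>l\<in>nbrs k. (fst (\<Phi> t x k) - fst (\<Phi> t x l)) * (snd (\<Phi> t x k) + snd (\<Phi> t x l)))"
    by (simp add: force_eq sum_distrib_left algebra_simps flip: sum.distrib sum_subtractf sum_negf)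
  ultimately show ?thesis by simp
qed

text \<open>Currents are quadratic in positions and momenta, so local energies dominate them at a
  rate independent of the configuration, although the forces are cubic.\<close>

lemma loc_en_flux_le:
  "- (K / 2) * (\<Sum>l\<in>nbrs k. (fst (x k) - fst (x l)) * (snd (x k) + snd (x l)))
    \<le> (1 + K * nnbrs TYPE('d)) * loc_en x k + K * (\<Sum>l\<in>nbrs k. loc_en x l)"
proof -
  have "- (K / 2) * (\<Sum>l\<in>nbrs k. (fst (x k) - fst (x l)) * (snd (x k) + snd (x l)))
      = K / 2 * (\<Sum>l\<in>nbrs k. - ((fst (x k) - fst (x l)) * (snd (x k) + snd (x l))))"
    by (simp add: sum_negf)
  also have "\<dots> \<le> K / 2 * (\<Sum>l\<in>nbrs k. (fst (x k) - fst (x l))\<^sup>2 / 2 + (2 * loc_en x k + 2 * loc_en x l))"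
  proof (intro mult_left_mono sum_mono)
    fix l
    define a b c where "a = fst (x k) - fst (x l)" and "b = snd (x k)" and "c = snd (x l)"
    have "0 \<le> (a + (b + c))\<^sup>2" "0 \<le> (b - c)\<^sup>2"
      by simp_all
    then have "- (a * (b + c)) \<le> a\<^sup>2 / 2 + (b\<^sup>2 + c\<^sup>2)"
      by (simp add: power2_sum power2_diff algebra_simps)
    moreover have "b\<^sup>2 \<le> 2 * loc_en x k" "c\<^sup>2 \<le> 2 * loc_en x l"
      using p_sq_le[of x k] p_sq_le[of x l] site_en_le_loc_en[of x k] site_en_le_loc_en[of x l]
      unfolding b_def c_def by linarith+
    ultimately show "- ((fst (x k) - fst (x l)) * (snd (x k) + snd (x l)))
        \<le> (fst (x k) - fst (x l))\<^sup>2 / 2 + (2 * loc_en x k + 2 * loc_en x l)"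
      unfolding a_def b_def c_def by linarith
  qed (use K_pos in simp)
  also have "\<dots> = K / 4 * (\<Sum>l\<in>nbrs k. (fst (x k) - fst (x l))\<^sup>2) + K * nnbrs TYPE('d) * loc_en x k
      + K * (\<Sum>l\<in>nbrs k. loc_en x l)"
    by (simp add: sum.distrib card_nbrs algebra_simps flip: sum_distrib_left sum_divide_distrib)
  also have "K / 4 * (\<Sum>l\<in>nbrs k. (fst (x k) - fst (x l))\<^sup>2) \<le> loc_en x k"
    using site_en_ge_1[of x k] by (simp add: loc_en_def)
  finally show ?thesis
    by (simp add: algebra_simps)
qed

lemma loc_en_le_lnw:
  "\<exists>C\<ge>1. \<forall>x B m k. 0 \<le> m \<longrightarrow> (\<forall>k. site_en x k \<le> B * lnw m k) \<longrightarrow> loc_en x k \<le> C * B * lnw m k"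
proof -
  obtain C where C: "1 \<le> C" "\<And>x k. loc_en x k \<le> C * (site_en x k + (\<Sum>l\<in>nbrs k. site_en x l))"
    using loc_en_le by blast
  define c where "c = C * (1 + 2 * nnbrs TYPE('d))"
  have "1 \<le> c"
    using mult_mono[of 1 C 1 "1 + 2 * nnbrs TYPE('d)"] C(1) by (simp add: c_def)
  have "loc_en x k \<le> c * B * lnw m k" if "0 \<le> m" and en: "\<And>k. site_en x k \<le> B * lnw m k" for x B m k
  proof -
    have "0 \<le> B"
      using en[of 0] site_en_ge_1[of x 0] lnw_ge_1[OF that(1), of "0 :: int ^ 'd"]
      by (smt (verit) mult_nonpos_nonneg)
    have "(\<Sum>l\<in>nbrs k. site_en x l) \<le> (\<Sum>l\<in>nbrs k. B * (2 * lnw m k))"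
      using \<open>0 \<le> B\<close> lnw_nbrs[OF that(1), of _ k]
      by (intro sum_mono order_trans[OF en] mult_left_mono) auto
    also have "\<dots> = 2 * nnbrs TYPE('d) * (B * lnw m k)"
      by (simp add: card_nbrs)
    finally have "site_en x k + (\<Sum>l\<in>nbrs k. site_en x l) \<le> (1 + 2 * nnbrs TYPE('d)) * (B * lnw m k)"
      using en[of k] by (simp add: algebra_simps)
    then have "C * (site_en x k + (\<Sum>l\<in>nbrs k. site_en x l)) \<le> C * ((1 + 2 * nnbrs TYPE('d)) * (B * lnw m k))"
      using C(1) by (intro mult_left_mono) auto
    then show ?thesis
      using C(2)[of x k] by (simp add: c_def mult.assoc)
  qed
  then show ?thesis
    using \<open>1 \<le> c\<close> by blast
qed

text \<open>The constant depends on \<open>T\<close> only, not on \<open>x\<close>, \<open>B\<close>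
  or \<open>m\<close>: a bound at an integer time is carried over the next unit interval with no
  loss accumulating in \<open>m\<close>.\<close>

lemma energy_propagation:
  assumes "0 \<le> T"
  shows "\<exists>C\<ge>0. \<forall>x B m \<tau> j. x \<in> phase_space \<longrightarrow> 0 \<le> m \<longrightarrow> (\<forall>k. site_en x k \<le> B * lnw m k) \<longrightarrow>
    0 \<le> \<tau> \<longrightarrow> \<tau> \<le> T \<longrightarrow> site_en (\<Phi> \<tau> x) j \<le> C * B * lnw m j"
proof -
  obtain S where S: "1 \<le> S"
    "\<And>(F :: (int ^ 'd) set) j. finite F \<Longrightarrow> (\<Sum>k\<in>F. exp (- rnorm (k - j))) \<le> S"
    using sum_lattice_exp_le by blast
  obtain CL where CL: "1 \<le> CL"
    "\<And>x B m k. 0 \<le> m \<Longrightarrow> (\<And>k. site_en x k \<le> B * lnw m k) \<Longrightarrow> loc_en x k \<le> CL * B * lnw m k"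
    using loc_en_le_lnw by blast
  define c where "c = 1 + K * nnbrs TYPE('d)"
  define D where "D = c + K * nnbrs TYPE('d) * exp (3 + 0)"
  have "0 \<le> c" "0 \<le> D"
    using K_pos by (auto simp: c_def D_def intro!: add_nonneg_nonneg)
  have "site_en (\<Phi> \<tau> x) j \<le> exp (T * D) * CL * S * B * lnw m j"
    if x: "x \<in> phase_space" and "0 \<le> m" and en: "\<And>k. site_en x k \<le> B * lnw m k"
      and "0 \<le> \<tau>" "\<tau> \<le> T" for x B m \<tau> j
  proof -
    have "0 \<le> B"
      using en[of 0] site_en_ge_1[of x 0] lnw_ge_1[OF that(2), of "0 :: int ^ 'd"]
      by (smt (verit) mult_nonpos_nonneg)
    obtain G where G: "0 \<le> G" "\<And>s k. \<bar>s\<bar> \<le> T \<Longrightarrow> site_en (\<Phi> s x) k \<le> G * lnw 0 k"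
      using flow_site_en_growth[OF x] by blast
    have "loc_en (\<Phi> \<tau> x) j \<le> exp (T * D) * CL * S * B * lnw m j"
    \<comment> \<open>The flux bound has a rate uniform in the site, so the part growing with
      \<open>k\<close> is absent.\<close>
    proof (rule weighted_comparison[where A = 0 and c = c and K = K and D = D and t = \<tau> and j = j
          and v = "\<lambda>s. loc_en (\<Phi> s x)" and B = "CL * G"])
      show "0 \<le> loc_en (\<Phi> s x) k" for s k
        using site_en_ge_1[of "\<Phi> s x" k] site_en_le_loc_en[of "\<Phi> s x" k] by linarith
      show "((\<lambda>s. loc_en (\<Phi> s x) k) has_real_derivative
        - (K / 2) * (\<Sum>l\<in>nbrs k. (fst (\<Phi> s x k) - fst (\<Phi> s x l)) * (snd (\<Phi> s x k) + snd (\<Phi> s x l)))) (at s)" for s k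
        by (rule loc_en_deriv[OF x])
      show "- (K / 2) * (\<Sum>l\<in>nbrs k. (fst (\<Phi> s x k) - fst (\<Phi> s x l)) * (snd (\<Phi> s x k) + snd (\<Phi> s x l)))
          \<le> (0 * lw \<tau> k + c) * loc_en (\<Phi> s x) k + K * (\<Sum>l\<in>nbrs k. loc_en (\<Phi> s x) l)" for s k
        using loc_en_flux_le by (simp add: c_def)
      show "loc_en (\<Phi> s x) k \<le> CL * G * (exp 1 + rnorm k)" if "0 \<le> s" "s \<le> \<tau>" for s k
      proof -
        have "loc_en (\<Phi> s x) k \<le> CL * G * lnw 0 k"
          using that \<open>\<tau> \<le> T\<close> by (intro CL(2) G(2)) auto
        also have "\<dots> \<le> CL * G * (exp 1 + rnorm k)"
          using CL(1) G(1) by (intro mult_left_mono lnw_le) auto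
        finally show ?thesis .
      qed
      show "(\<Sum>k\<in>F. exp (- 3 * rnorm (k - j) + \<tau> * (0 * lw \<tau> k + D)) * loc_en (\<Phi> 0 x) k)
          \<le> exp (T * D) * CL * S * B * lnw m j" if "finite F" for F
      proof -
        have L: "0 \<le> CL * B * lnw m j"
          using CL(1) \<open>0 \<le> B\<close> lnw_ge_1[OF \<open>0 \<le> m\<close>, of j] by simp
        have "exp (- 3 * rnorm (k - j) + \<tau> * (0 * lw \<tau> k + D)) * loc_en (\<Phi> 0 x) k
            \<le> exp (T * D) * (CL * B * lnw m j) * exp (- rnorm (k - j))" for k
        \<comment> \<open>One unit of decay pays for the shift of the logarithm, by
          \<open>1 + rnorm (k - j) \<le> exp (rnorm (k - j))\<close>, one is kept for summability
          and the third is dropped.\<close>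
        proof -
          let ?r = "rnorm (k - j)"
          have "loc_en (\<Phi> 0 x) k \<le> CL * B * lnw m k"
            unfolding flow_0[OF x] by (intro CL(2) en \<open>0 \<le> m\<close>)
          also have "\<dots> \<le> CL * B * (lnw m j * (1 + ?r))"
            using CL(1) \<open>0 \<le> B\<close> by (intro mult_left_mono lnw_shift \<open>0 \<le> m\<close>) auto
          also have "\<dots> \<le> CL * B * lnw m j * exp ?r"
            using L mult_left_mono[OF exp_ge_add_one_self[of ?r] L] by (simp add: mult.assoc)
          finally have 1: "loc_en (\<Phi> 0 x) k \<le> CL * B * lnw m j * exp ?r" .
          have "\<tau> * D \<le> T * D"
            using \<open>\<tau> \<le> T\<close> \<open>0 \<le> D\<close> by (intro mult_right_mono)
          then have 2: "exp (- 3 * ?r + \<tau> * (0 * lw \<tau> k + D)) \<le> exp (- 2 * ?r + T * D)"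
            by (simp add: add_increasing)
          have "exp (- 3 * ?r + \<tau> * (0 * lw \<tau> k + D)) * loc_en (\<Phi> 0 x) k
              \<le> exp (- 2 * ?r + T * D) * (CL * B * lnw m j * exp ?r)"
            using 1 2 site_en_ge_1[of "\<Phi> 0 x" k] site_en_le_loc_en[of "\<Phi> 0 x" k]
            by (intro mult_mono) auto
          also have "\<dots> = exp (T * D) * (CL * B * lnw m j) * (exp (- 2 * ?r) * exp ?r)"
            by (simp only: exp_add mult_ac)
          also have "exp (- 2 * ?r) * exp ?r = exp (- ?r)"
            by (simp flip: exp_add)
          finally show ?thesis .
        qed
        then have "(\<Sum>k\<in>F. exp (- 3 * rnorm (k - j) + \<tau> * (0 * lw \<tau> k + D)) * loc_en (\<Phi> 0 x) k)
            \<le> exp (T * D) * (CL * B * lnw m j) * (\<Sum>k\<in>F. exp (- rnorm (k - j)))"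
          by (subst sum_distrib_left) (intro sum_mono)
        also have "\<dots> \<le> exp (T * D) * (CL * B * lnw m j) * S"
          using L that by (intro mult_left_mono S) auto
        finally show ?thesis
          by (simp add: mult_ac)
      qed
    qed (use \<open>0 \<le> \<tau>\<close> \<open>0 \<le> c\<close> K_pos D_def in auto)
    then show ?thesis
      using site_en_le_loc_en[of "\<Phi> \<tau> x" j] by linarith
  qed
  moreover have "0 \<le> exp (T * D) * CL * S"
    using CL(1) S(1) by simp
  ultimately show ?thesis
    by blast
qed

text \<open>The comparison is applied to the squared distance of the two orbits at each site.
  Initially it vanishes off \<open>i\<close>, so the weighted initial sum has a single term, and
  that term carries the decay in \<open>|i - j|\<close>.\<close>

lemma perturbation_bound:
  assumes "0 \<le> A"
  shows "\<exists>C\<ge>0. \<forall>x y t i j. x \<in> phase_space \<longrightarrow> y \<in> phase_space \<longrightarrow> 0 \<le> t \<longrightarrow> (\<forall>k. k \<noteq> i \<longrightarrow> x k = y k) \<longrightarrow>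
    (\<forall>\<tau> k. 0 \<le> \<tau> \<longrightarrow> \<tau> \<le> t \<longrightarrow> (fst (\<Phi> \<tau> x k))\<^sup>2 \<le> A * lw t k \<and> (fst (\<Phi> \<tau> y k))\<^sup>2 \<le> A * lw t k) \<longrightarrow>
    (norm (\<Phi> t x j - \<Phi> t y j))\<^sup>2 \<le> (norm (x i - y i))\<^sup>2 * exp (- 3 * rnorm (i - j) + t * (C * lw t i + C))"
proof -
  obtain CU where CU: "0 \<le> CU"
    "\<And>x y. \<bar>poly (pderiv P) x - poly (pderiv P) y\<bar> \<le> CU * (1 + x\<^sup>2 + y\<^sup>2) * \<bar>x - y\<bar>"
    using quartic_deriv_lipschitz[OF degree_P] by blast
  obtain CQ where CQ: "1 \<le> CQ" "\<And>(x :: 'd cfg) k. (fst (x k))\<^sup>2 \<le> CQ * site_en x k"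
    using q_sq_le by blast
  \<comment> \<open>\<open>A'\<close> is the Lipschitz rate of \<open>pderiv P\<close> in units of
    \<open>lw t k \<ge> 1\<close> when both orbits satisfy
    \<open>q\<^sup>2 \<le> A * lw t k\<close>. In \<open>c\<close>, the 1 stems from
    \<open>2 * a * b\<close> and the rest from the harmonic coupling.\<close>
  define A' where "A' = CU * (1 + 2 * A)"
  define c where "c = 1 + 2 * K * nnbrs TYPE('d)"
  define D where "D = c + K * nnbrs TYPE('d) * exp (3 + A')"
  have "0 \<le> A'" "0 \<le> c" "0 \<le> D"
    using K_pos assms CU(1) by (auto simp: A'_def c_def D_def intro!: add_nonneg_nonneg mult_nonneg_nonneg)
  have "(norm (\<Phi> t x j - \<Phi> t y j))\<^sup>2 \<le> (norm (x i - y i))\<^sup>2 * exp (- 3 * rnorm (i - j) + t * ((A' + D) * lw t i + (A' + D)))"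
    if x: "x \<in> phase_space" and y: "y \<in> phase_space" and "0 \<le> t" and xy: "\<And>k. k \<noteq> i \<Longrightarrow> x k = y k"
      and q: "\<And>\<tau> k. 0 \<le> \<tau> \<Longrightarrow> \<tau> \<le> t \<Longrightarrow> (fst (\<Phi> \<tau> x k))\<^sup>2 \<le> A * lw t k \<and> (fst (\<Phi> \<tau> y k))\<^sup>2 \<le> A * lw t k"
    for x y t i j
  proof -
    define a where "a \<tau> k = fst (\<Phi> \<tau> x k) - fst (\<Phi> \<tau> y k)" for \<tau> k
    define b where "b \<tau> k = snd (\<Phi> \<tau> x k) - snd (\<Phi> \<tau> y k)" for \<tau> k
    define f where "f \<tau> k = force (poly (pderiv P)) K (\<Phi> \<tau> x) k - force (poly (pderiv P)) K (\<Phi> \<tau> y) k" for \<tau> k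
    define v where "v \<tau> k = (a \<tau> k)\<^sup>2 + (b \<tau> k)\<^sup>2" for \<tau> k
    have v_norm: "v \<tau> k = (norm (\<Phi> \<tau> x k - \<Phi> \<tau> y k))\<^sup>2" for \<tau> k
      by (simp add: v_def a_def b_def norm_prod_def)
    obtain Gx where Gx: "0 \<le> Gx" "\<And>s k. \<bar>s\<bar> \<le> t \<Longrightarrow> site_en (\<Phi> s x) k \<le> Gx * lnw 0 k"
      using flow_site_en_growth[OF x] by blast
    obtain Gy where Gy: "0 \<le> Gy" "\<And>s k. \<bar>s\<bar> \<le> t \<Longrightarrow> site_en (\<Phi> s y) k \<le> Gy * lnw 0 k"
      using flow_site_en_growth[OF y] by blast
    define S where "S = (norm (x i - y i))\<^sup>2 * exp (- 3 * rnorm (i - j) + t * (A' * lw t i + D))"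
    have "v t j \<le> S"
    proof (rule weighted_comparison[where A = A' and c = c and K = K and D = D and t = t and j = j
          and v = v and B = "(2 * CQ + 4) * (Gx + Gy)"])
      show "0 \<le> v \<tau> k" for \<tau> k
        by (simp add: v_def)
      show "((\<lambda>\<tau>. v \<tau> k) has_real_derivative 2 * a \<tau> k * b \<tau> k + 2 * b \<tau> k * f \<tau> k) (at \<tau>)" for \<tau> k
        unfolding v_def a_def b_def f_def
        by (auto intro!: derivative_eq_intros flow_q[OF x] flow_p[OF x] flow_q[OF y] flow_p[OF y]
            simp: algebra_simps)
      show "2 * a \<tau> k * b \<tau> k + 2 * b \<tau> k * f \<tau> k \<le> (A' * lw t k + c) * v \<tau> k + K * (\<Sum>l\<in>nbrs k. v \<tau> l)"
        if "0 \<le> \<tau>" "\<tau> \<le> t" for \<tau> k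
      proof -
        define u where "u = poly (pderiv P) (fst (\<Phi> \<tau> x k)) - poly (pderiv P) (fst (\<Phi> \<tau> y k))"
        have ab: "2 * \<bar>a \<tau> k\<bar> * \<bar>b \<tau> k\<bar> \<le> v \<tau> k"
          using sum_squares_bound[of "\<bar>a \<tau> k\<bar>" "\<bar>b \<tau> k\<bar>"] by (simp add: v_def)
        have "\<bar>u\<bar> \<le> CU * (1 + (fst (\<Phi> \<tau> x k))\<^sup>2 + (fst (\<Phi> \<tau> y k))\<^sup>2) * \<bar>a \<tau> k\<bar>"
          unfolding u_def a_def by (rule CU(2))
        also have "\<dots> \<le> CU * (lw t k + A * lw t k + A * lw t k) * \<bar>a \<tau> k\<bar>"
          using q[OF that, of k] lw_ge_1[OF \<open>0 \<le> t\<close>, of k] CU(1)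
          by (intro mult_left_mono mult_right_mono add_mono) auto
        also have "\<dots> = A' * lw t k * \<bar>a \<tau> k\<bar>"
          by (simp add: A'_def algebra_simps)
        finally have u: "\<bar>u\<bar> \<le> A' * lw t k * \<bar>a \<tau> k\<bar>" .
        define r where "r = (\<Sum>l\<in>nbrs k. a \<tau> k - a \<tau> l)"
        have "r = (\<Sum>l\<in>nbrs k. fst (\<Phi> \<tau> x k) - fst (\<Phi> \<tau> x l)) - (\<Sum>l\<in>nbrs k. fst (\<Phi> \<tau> y k) - fst (\<Phi> \<tau> y l))"
          unfolding r_def sum_subtractf[symmetric] by (intro sum.cong) (simp_all add: a_def)
        then have f_eq: "f \<tau> k = - u - K * r"
          unfolding f_def force_eq u_def by (simp add: right_diff_distrib)
        have sum_eq: "(\<Sum>l\<in>nbrs k. - 2 * b \<tau> k * (a \<tau> k - a \<tau> l)) = - 2 * b \<tau> k * r"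
          unfolding r_def by (rule sum_distrib_left[symmetric])
        have "2 * b \<tau> k * f \<tau> k = - 2 * b \<tau> k * u + K * (\<Sum>l\<in>nbrs k. - 2 * b \<tau> k * (a \<tau> k - a \<tau> l))"
          unfolding f_eq sum_eq by (simp add: algebra_simps)
        also have "- 2 * b \<tau> k * u \<le> A' * lw t k * v \<tau> k"
        proof -
          have "- 2 * b \<tau> k * u \<le> \<bar>2 * b \<tau> k * u\<bar>"
            by linarith
          also have "\<dots> = 2 * \<bar>b \<tau> k\<bar> * \<bar>u\<bar>"
            by (simp add: abs_mult)
          also have "\<dots> \<le> 2 * \<bar>b \<tau> k\<bar> * (A' * lw t k * \<bar>a \<tau> k\<bar>)"
            using u by (intro mult_left_mono) auto
          also have "\<dots> = A' * lw t k * (2 * \<bar>a \<tau> k\<bar> * \<bar>b \<tau> k\<bar>)"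
            by simp
          also have "\<dots> \<le> A' * lw t k * v \<tau> k"
            using ab \<open>0 \<le> A'\<close> lw_ge_1[OF \<open>0 \<le> t\<close>, of k] by (intro mult_left_mono) auto
          finally show ?thesis .
        qed
        also have "(\<Sum>l\<in>nbrs k. - 2 * b \<tau> k * (a \<tau> k - a \<tau> l)) \<le> (\<Sum>l\<in>nbrs k. 2 * v \<tau> k + v \<tau> l)"
        proof (rule sum_mono)
          fix l
          \<comment> \<open>This sum of squares is exactly the right side minus the left side of the
            claim.\<close>
          have "0 \<le> (b \<tau> k + a \<tau> k)\<^sup>2 + (b \<tau> k - a \<tau> l)\<^sup>2 + (a \<tau> k)\<^sup>2 + (b \<tau> l)\<^sup>2"
            by simp
          then show "- 2 * b \<tau> k * (a \<tau> k - a \<tau> l) \<le> 2 * v \<tau> k + v \<tau> l"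
            by (simp add: v_def power2_sum power2_diff algebra_simps)
        qed
        also have "\<dots> = 2 * nnbrs TYPE('d) * v \<tau> k + (\<Sum>l\<in>nbrs k. v \<tau> l)"
          by (simp add: sum.distrib card_nbrs)
        finally have "2 * b \<tau> k * f \<tau> k \<le> A' * lw t k * v \<tau> k + K * (2 * nnbrs TYPE('d) * v \<tau> k + (\<Sum>l\<in>nbrs k. v \<tau> l))"
          using K_pos by simp
        moreover have "2 * a \<tau> k * b \<tau> k \<le> v \<tau> k"
          using sum_squares_bound[of "a \<tau> k" "b \<tau> k"] by (simp add: v_def)
        ultimately show ?thesis
          by (simp add: c_def algebra_simps)
      qed
      show "v \<tau> k \<le> (2 * CQ + 4) * (Gx + Gy) * (exp 1 + rnorm k)" if "0 \<le> \<tau>" "\<tau> \<le> t" for \<tau> k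
      proof -
        have sq: "(r - s)\<^sup>2 \<le> 2 * r\<^sup>2 + 2 * s\<^sup>2" for r s :: real
          using zero_le_power2[of "r + s"] by (simp add: power2_diff power2_sum)
        let ?e = "site_en (\<Phi> \<tau> x) k + site_en (\<Phi> \<tau> y) k"
        have "v \<tau> k \<le> 2 * (CQ * ?e) + 2 * (2 * ?e)"
          using CQ(2)[of "\<Phi> \<tau> x" k] CQ(2)[of "\<Phi> \<tau> y" k] p_sq_le[of "\<Phi> \<tau> x" k] p_sq_le[of "\<Phi> \<tau> y" k]
            sq[of "fst (\<Phi> \<tau> x k)" "fst (\<Phi> \<tau> y k)"] sq[of "snd (\<Phi> \<tau> x k)" "snd (\<Phi> \<tau> y k)"]
          unfolding v_def a_def b_def by (simp add: algebra_simps)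
        also have "\<dots> = (2 * CQ + 4) * ?e"
          by (simp add: algebra_simps)
        also have "\<dots> \<le> (2 * CQ + 4) * ((Gx + Gy) * lnw 0 k)"
          using Gx(2)[of \<tau> k] Gy(2)[of \<tau> k] that CQ(1)
          by (intro mult_left_mono) (auto simp: algebra_simps)
        also have "\<dots> \<le> (2 * CQ + 4) * ((Gx + Gy) * (exp 1 + rnorm k))"
          using Gx(1) Gy(1) CQ(1) by (intro mult_left_mono lnw_le) auto
        finally show ?thesis
          by (simp add: mult.assoc)
      qed
      show "(\<Sum>k\<in>F. exp (- 3 * rnorm (k - j) + t * (A' * lw t k + D)) * v 0 k) \<le> S" if "finite F" for F
      proof -
        have "(\<Sum>k\<in>F. exp (- 3 * rnorm (k - j) + t * (A' * lw t k + D)) * v 0 k) = (\<Sum>k\<in>F. if k = i then S else 0)"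
        proof (rule sum.cong)
          show "exp (- 3 * rnorm (k - j) + t * (A' * lw t k + D)) * v 0 k = (if k = i then S else 0)" for k
            using xy[of k] by (simp add: v_norm flow_0[OF x] flow_0[OF y] S_def)
        qed simp
        also have "\<dots> \<le> S"
          using that by (simp add: S_def)
        finally show ?thesis .
      qed
    qed (use \<open>0 \<le> t\<close> \<open>0 \<le> A'\<close> \<open>0 \<le> c\<close> K_pos D_def in auto)
    also have "S \<le> (norm (x i - y i))\<^sup>2 * exp (- 3 * rnorm (i - j) + t * ((A' + D) * lw t i + (A' + D)))"
    proof -
      have "A' * lw t i + D \<le> (A' + D) * lw t i + (A' + D)"
        using \<open>0 \<le> A'\<close> \<open>0 \<le> D\<close> lw_ge_1[OF \<open>0 \<le> t\<close>, of i] by (intro add_mono mult_right_mono) auto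
      then show ?thesis
        using \<open>0 \<le> t\<close> by (auto simp: S_def intro!: mult_left_mono)
    qed
    finally show ?thesis
      by (simp add: v_norm)
  qed
  moreover have "0 \<le> A' + D"
    using \<open>0 \<le> A'\<close> \<open>0 \<le> D\<close> by simp
  ultimately show ?thesis
    by blast
qed

end

section \<open>The bracket outside the light cone\<close>

context quartic_lattice
begin

text \<open>
  The bound on the perturbed orbit needed for \<open>perturbation_bound\<close> is bootstrapped: the a priori
  energy estimate gives it with a constant depending on \<open>x\<close> and \<open>t\<close>, hence continuity in the
  perturbation uniformly in the site and in \<open>\<tau> \<le> t\<close>; for small perturbations the constant of the
  unperturbed orbit is then good enough.
\<close>

lemma variation_bound:
  assumes "0 \<le> A"
  shows "\<exists>C\<ge>0. \<forall>x t i j. x \<in> phase_space \<longrightarrow> 0 \<le> t \<longrightarrow>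
    (\<forall>\<tau> k. 0 \<le> \<tau> \<longrightarrow> \<tau> \<le> t \<longrightarrow> (fst (\<Phi> \<tau> x k))\<^sup>2 \<le> A * lw t k) \<longrightarrow>
    (\<exists>\<sigma>>0. \<forall>z. norm (z - x i) < \<sigma> \<longrightarrow>
      norm (\<Phi> t (x(i := z)) j - \<Phi> t x j) \<le> norm (z - x i) * exp (- 3 / 2 * rnorm (i - j) + t * (C * lw t i + C)))"
proof -
  \<comment> \<open>\<open>2 * A + 2\<close> is what a perturbed orbit satisfies once it stays
    within distance 1 of the given one, by
    \<open>v\<^sup>2 \<le> 2 * u\<^sup>2 + 2 * (v - u)\<^sup>2\<close>. The constant
    \<open>C\<close> is fixed before \<open>x\<close> and \<open>t\<close>.\<close>
  obtain C where "0 \<le> C" and C: "\<And>x y t i j. x \<in> phase_space \<Longrightarrow> y \<in> phase_space \<Longrightarrow> 0 \<le> t \<Longrightarrow>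
      (\<And>k. k \<noteq> i \<Longrightarrow> x k = y k) \<Longrightarrow>
      (\<And>\<tau> k. 0 \<le> \<tau> \<Longrightarrow> \<tau> \<le> t \<Longrightarrow>
        (fst (\<Phi> \<tau> x k))\<^sup>2 \<le> (2 * A + 2) * lw t k \<and> (fst (\<Phi> \<tau> y k))\<^sup>2 \<le> (2 * A + 2) * lw t k) \<Longrightarrow>
      (norm (\<Phi> t x j - \<Phi> t y j))\<^sup>2 \<le> (norm (x i - y i))\<^sup>2 * exp (- 3 * rnorm (i - j) + t * (C * lw t i + C))"
    using perturbation_bound[of "2 * A + 2"] assms by (auto 0 0)
  have "\<exists>\<sigma>>0. \<forall>z. norm (z - x i) < \<sigma> \<longrightarrow>
      norm (\<Phi> t (x(i := z)) j - \<Phi> t x j) \<le> norm (z - x i) * exp (- 3 / 2 * rnorm (i - j) + t * (C * lw t i + C))"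
    if x: "x \<in> phase_space" and t: "0 \<le> t"
      and q: "\<And>\<tau> k. 0 \<le> \<tau> \<Longrightarrow> \<tau> \<le> t \<Longrightarrow> (fst (\<Phi> \<tau> x k))\<^sup>2 \<le> A * lw t k" for x t i j
  proof -
    obtain CE where "0 \<le> CE" and CE: "\<And>x B m \<tau> j. x \<in> phase_space \<Longrightarrow> 0 \<le> m \<Longrightarrow>
        (\<And>k. site_en x k \<le> B * lnw m k) \<Longrightarrow> 0 \<le> \<tau> \<Longrightarrow> \<tau> \<le> t \<Longrightarrow> site_en (\<Phi> \<tau> x) j \<le> CE * B * lnw m j"
      using energy_propagation[OF t] by blast
    obtain CQ where "0 \<le> CQ" and CQ: "\<And>x k B t. 0 \<le> t \<Longrightarrow> site_en x k \<le> B * lnw t k \<Longrightarrow> (fst (x k))\<^sup>2 \<le> CQ * sqrt B * lw t k"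
      using q_sq_le_lw by blast
    obtain G where "0 \<le> G" and "\<And>s k. \<bar>s\<bar> \<le> 0 \<Longrightarrow> site_en (\<Phi> s x) k \<le> G * lnw 0 k"
      using flow_site_en_growth[OF x, of 0] by blast
    then have G: "site_en x k \<le> G * lnw 0 k" for k
      using flow_0[OF x] by (metis abs_zero order_refl)
    define e where "e z = (snd z)\<^sup>2 / 2 + poly P (fst z) + 1" for z :: "real \<times> real"
    \<comment> \<open>Compactness bounds the energy at \<open>i\<close> uniformly over all
      replacements \<open>z\<close> in the unit ball; at other sites the energy
      \<open>site_en\<close> is unchanged.\<close>
    have "compact (e ` cball (x i) 1)"
      unfolding e_def by (intro compact_continuous_image continuous_intros compact_cball) auto
    then have "bounded (e ` cball (x i) 1)"
      by (rule compact_imp_bounded)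
    then obtain M where "0 < M" and M: "\<And>z. z \<in> cball (x i) 1 \<Longrightarrow> norm (e z) \<le> M"
      unfolding bounded_pos by blast
    define A1 where "A1 = CQ * sqrt (CE * (G + M))"
    have "0 \<le> A1"
      using \<open>0 \<le> CQ\<close> \<open>0 \<le> CE\<close> \<open>0 \<le> G\<close> \<open>0 < M\<close> by (simp add: A1_def)
    have A1: "(fst (\<Phi> \<tau> (x(i := z)) k))\<^sup>2 \<le> A1 * lw 0 k"
      if "norm (z - x i) \<le> 1" "0 \<le> \<tau>" "\<tau> \<le> t" for z \<tau> k
    proof -
      have "site_en (x(i := z)) k \<le> (G + M) * lnw 0 k" for k
      proof (cases "k = i")
        case True
        have "site_en (x(i := z)) k \<le> M * 1"
          using M[of z] that(1) True by (simp add: site_en_def e_def dist_norm norm_minus_commute)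
        also have "\<dots> \<le> (G + M) * lnw 0 k"
          using lnw_ge_1[of 0 k] \<open>0 \<le> G\<close> \<open>0 < M\<close> by (intro mult_mono) auto
        finally show ?thesis .
      next
        case False
        then have "site_en (x(i := z)) k = site_en x k"
          by (simp add: site_en_def)
        also have "\<dots> \<le> G * lnw 0 k"
          by (rule G)
        also have "\<dots> \<le> (G + M) * lnw 0 k"
          using lnw_ge_1[of 0 k] \<open>0 < M\<close> by (intro mult_right_mono) auto
        finally show ?thesis .
      qed
      then have "site_en (\<Phi> \<tau> (x(i := z))) k \<le> CE * (G + M) * lnw 0 k"
        using that by (intro CE phase_space_upd x) auto
      then show ?thesis
        unfolding A1_def by (rule CQ[OF order_refl])
    qed
    obtain C1 where "0 \<le> C1" and C1: "\<And>x y t i j. x \<in> phase_space \<Longrightarrow> y \<in> phase_space \<Longrightarrow> 0 \<le> t \<Longrightarrow>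
        (\<And>k. k \<noteq> i \<Longrightarrow> x k = y k) \<Longrightarrow>
        (\<And>\<tau> k. 0 \<le> \<tau> \<Longrightarrow> \<tau> \<le> t \<Longrightarrow>
          (fst (\<Phi> \<tau> x k))\<^sup>2 \<le> A1 * lw t k \<and> (fst (\<Phi> \<tau> y k))\<^sup>2 \<le> A1 * lw t k) \<Longrightarrow>
        (norm (\<Phi> t x j - \<Phi> t y j))\<^sup>2 \<le> (norm (x i - y i))\<^sup>2 * exp (- 3 * rnorm (i - j) + t * (C1 * lw t i + C1))"
      using perturbation_bound[OF \<open>0 \<le> A1\<close>] by (auto 0 0)
    define E where "E = exp (t * (C1 * lw t i + C1))"
    have "0 < E"
      by (simp add: E_def)
    \<comment> \<open>With this radius the crude estimate with rate \<open>C1\<close> keeps the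
      perturbed orbit within distance 1 of the unperturbed one, at every site and up to time
      \<open>t\<close>.\<close>
    define \<sigma> where "\<sigma> = min 1 (1 / sqrt E)"
    have close: "(norm (\<Phi> \<tau> (x(i := z)) k - \<Phi> \<tau> x k))\<^sup>2 \<le> 1"
      if z: "norm (z - x i) < \<sigma>" and \<tau>: "0 \<le> \<tau>" "\<tau> \<le> t" for z \<tau> k
    proof -
      have A1_lw: "(fst (\<Phi> s (x(i := w)) l))\<^sup>2 \<le> A1 * lw \<tau> l"
        if "norm (w - x i) \<le> 1" "0 \<le> s" "s \<le> \<tau>" for w s l
        using A1[of w s l] that \<tau> mult_left_mono[OF lw_mono[of 0 \<tau> l] \<open>0 \<le> A1\<close>] by simp
      have "(norm (\<Phi> \<tau> (x(i := z)) k - \<Phi> \<tau> x k))\<^sup>2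
          \<le> (norm ((x(i := z)) i - x i))\<^sup>2 * exp (- 3 * rnorm (i - k) + \<tau> * (C1 * lw \<tau> i + C1))"
      proof (rule C1)
        show "(fst (\<Phi> s (x(i := z)) l))\<^sup>2 \<le> A1 * lw \<tau> l \<and> (fst (\<Phi> s x l))\<^sup>2 \<le> A1 * lw \<tau> l"
          if "0 \<le> s" "s \<le> \<tau>" for s l
          using A1_lw[of z s l] A1_lw[of "x i" s l] z that by (simp add: \<sigma>_def)
      qed (use x \<tau> phase_space_upd in auto)
      also have "\<dots> \<le> (1 / sqrt E)\<^sup>2 * E"
      proof (rule mult_mono)
        have "C1 * lw \<tau> i + C1 \<le> C1 * lw t i + C1"
          using \<tau> \<open>0 \<le> C1\<close> by (intro add_right_mono mult_left_mono lw_mono)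
        moreover have "0 \<le> C1 * lw \<tau> i + C1"
          using \<open>0 \<le> C1\<close> lw_ge_1[OF \<tau>(1), of i] by simp
        ultimately have "\<tau> * (C1 * lw \<tau> i + C1) \<le> t * (C1 * lw t i + C1)"
          using \<tau> by (intro mult_mono) auto
        then show "exp (- 3 * rnorm (i - k) + \<tau> * (C1 * lw \<tau> i + C1)) \<le> E"
          using rnorm_nonneg[of "i - k"] unfolding E_def exp_le_cancel_iff by linarith
        show "(norm ((x(i := z)) i - x i))\<^sup>2 \<le> (1 / sqrt E)\<^sup>2"
          using z by (intro power_mono) (auto simp: \<sigma>_def)
      qed auto
      also have "\<dots> = 1"
        using \<open>0 < E\<close> by (simp add: power_divide)
      finally show ?thesis .
    qed
    have "norm (\<Phi> t (x(i := z)) j - \<Phi> t x j) \<le> norm (z - x i) * exp (- 3 / 2 * rnorm (i - j) + t * (C * lw t i + C))"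
      if z: "norm (z - x i) < \<sigma>" for z
    proof -
      define R where "R = - 3 * rnorm (i - j) + t * (C * lw t i + C)"
      have "(norm (\<Phi> t (x(i := z)) j - \<Phi> t x j))\<^sup>2 \<le> (norm ((x(i := z)) i - x i))\<^sup>2 * exp R"
        unfolding R_def
      proof (rule C)
        fix \<tau> k assume \<tau>: "0 \<le> \<tau>" "\<tau> \<le> t"
        define u v where "u = fst (\<Phi> \<tau> x k)" and "v = fst (\<Phi> \<tau> (x(i := z)) k)"
        have lw: "1 \<le> lw t k"
          by (rule lw_ge_1[OF t])
        have u: "u\<^sup>2 \<le> A * lw t k"
          using q[OF \<tau>, of k] by (simp add: u_def)
        have "(v - u)\<^sup>2 \<le> (norm (\<Phi> \<tau> (x(i := z)) k - \<Phi> \<tau> x k))\<^sup>2"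
          by (simp add: norm_prod_def u_def v_def)
        then have "(v - u)\<^sup>2 \<le> 1"
          using close[OF z \<tau>, of k] by linarith
        moreover have "v\<^sup>2 \<le> 2 * u\<^sup>2 + 2 * (v - u)\<^sup>2"
          using zero_le_power2[of "2 * u - v"] by (simp add: power2_diff algebra_simps)
        ultimately have "v\<^sup>2 \<le> (2 * A + 2) * lw t k"
          using u lw unfolding distrib_right by linarith
        moreover have "u\<^sup>2 \<le> (2 * A + 2) * lw t k"
          using u lw assms mult_nonneg_nonneg[of A "lw t k"] unfolding distrib_right by linarith
        ultimately show "(fst (\<Phi> \<tau> (x(i := z)) k))\<^sup>2 \<le> (2 * A + 2) * lw t k \<and> (fst (\<Phi> \<tau> x k))\<^sup>2 \<le> (2 * A + 2) * lw t k"
          by (simp add: u_def v_def)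
      qed (use x t phase_space_upd in auto)
      also have "\<dots> = (norm (z - x i) * exp (R / 2))\<^sup>2"
        by (simp add: power_mult_distrib flip: exp_double)
      finally have "norm (\<Phi> t (x(i := z)) j - \<Phi> t x j) \<le> norm (z - x i) * exp (R / 2)"
        by (rule power2_le_imp_le) simp
      \<comment> \<open>The square root halves the whole exponent; the growth term is nonnegative,
        so its half may be replaced by the whole.\<close>
      also have "\<dots> \<le> norm (z - x i) * exp (- 3 / 2 * rnorm (i - j) + t * (C * lw t i + C))"
      proof -
        have "0 \<le> t * (C * lw t i + C)"
          using t \<open>0 \<le> C\<close> lw_ge_1[OF t, of i] by simp
        then show ?thesis
          by (intro mult_left_mono) (auto simp: R_def)
      qed
      finally show ?thesis .
    qed
    moreover have "0 < \<sigma>"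
      using \<open>0 < E\<close> by (simp add: \<sigma>_def)
    ultimately show ?thesis
      by blast
  qed
  then show ?thesis
    using \<open>0 \<le> C\<close> by blast
qed

text \<open>Restart the orbit at the integer part of \<open>\<tau>\<close>: the propagation estimate
  covers the remaining time, which is at most 1, and \<open>lnw\<close> increases with time, so the
  bound obtained from \<open>m \<le> t\<close> also holds with \<open>t\<close>.\<close>

lemma orbit_bound:
  assumes x: "x \<in> phase_space" and B: "\<And>(m :: nat) k. site_en (\<Phi> (real m) x) k \<le> B * lnw (real m) k"
  shows "\<exists>A\<ge>0. \<forall>t \<tau> k. 0 \<le> \<tau> \<longrightarrow> \<tau> \<le> t \<longrightarrow> (fst (\<Phi> \<tau> x k))\<^sup>2 \<le> A * lw t k"
proof -
  obtain CE where "0 \<le> CE" and CE: "\<And>x B m \<tau> j. x \<in> phase_space \<Longrightarrow> 0 \<le> m \<Longrightarrow>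
      (\<And>k. site_en x k \<le> B * lnw m k) \<Longrightarrow> 0 \<le> \<tau> \<Longrightarrow> \<tau> \<le> 1 \<Longrightarrow> site_en (\<Phi> \<tau> x) j \<le> CE * B * lnw m j"
    using energy_propagation[of 1] by auto
  obtain CQ where "0 \<le> CQ" and CQ: "\<And>x k B t. 0 \<le> t \<Longrightarrow> site_en x k \<le> B * lnw t k \<Longrightarrow> (fst (x k))\<^sup>2 \<le> CQ * sqrt B * lw t k"
    using q_sq_le_lw by blast
  have "0 \<le> B"
    using B[of 0 0] site_en_ge_1[of "\<Phi> 0 x" 0] lnw_ge_1[of 0 "0 :: int ^ 'd"]
    by (smt (verit) mult_nonpos_nonneg of_nat_0)
  have "(fst (\<Phi> \<tau> x k))\<^sup>2 \<le> CQ * sqrt (CE * B) * lw t k" if "0 \<le> \<tau>" "\<tau> \<le> t" for t \<tau> k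
  proof -
    define m where "m = nat \<lfloor>\<tau>\<rfloor>"
    have m: "real m \<le> \<tau>" "\<tau> - real m \<le> 1"
      using that(1) by (simp_all add: m_def) linarith+
    have "site_en (\<Phi> (\<tau> - real m) (\<Phi> (real m) x)) k \<le> CE * B * lnw (real m) k"
      using m by (intro CE B flow_phase_space x) auto
    then have "site_en (\<Phi> \<tau> x) k \<le> CE * B * lnw (real m) k"
      using flow_add[OF x, of "\<tau> - real m" "real m"] by simp
    also have "\<dots> \<le> CE * B * lnw t k"
      using m that \<open>0 \<le> CE\<close> \<open>0 \<le> B\<close> by (intro mult_left_mono lnw_mono) auto
    finally show ?thesis
      using that by (intro CQ) auto
  qed
  moreover have "0 \<le> CQ * sqrt (CE * B)"
    using \<open>0 \<le> CQ\<close> \<open>0 \<le> CE\<close> \<open>0 \<le> B\<close> by simp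
  ultimately show ?thesis
    by blast
qed

end

section \<open>From Lipschitz bounds to the Poisson bracket\<close>

lemma abs_deriv_le:
  fixes h :: "real \<Rightarrow> real"
  assumes "h differentiable (at s)" and "0 < \<sigma>"
    and "\<And>y. \<bar>y - s\<bar> < \<sigma> \<Longrightarrow> \<bar>h y - h s\<bar> \<le> C * \<bar>y - s\<bar>"
  shows "\<bar>deriv h s\<bar> \<le> C"
proof -
  have "(h has_real_derivative deriv h s) (at s)"
    using assms(1) DERIV_deriv_iff_real_differentiable by blast
  then have "((\<lambda>u. \<bar>(h (s + u) - h s) / u\<bar>) \<longlongrightarrow> \<bar>deriv h s\<bar>) (at 0)"
    unfolding DERIV_def by (rule tendsto_rabs)
  moreover have "\<forall>\<^sub>F u in at 0. \<bar>(h (s + u) - h s) / u\<bar> \<le> C"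
    unfolding eventually_at using assms(2) assms(3)[of "s + _"]
    by (auto intro!: exI[of _ \<sigma>] simp: divide_le_eq abs_divide dist_norm)
  ultimately show ?thesis
    by (rule tendsto_upperbound) simp
qed

lemma bounded_derivative_lipschitz:
  fixes h :: "'a::real_normed_vector \<Rightarrow> real"
  assumes "\<forall>z. (h has_derivative h' z) (at z)" and "bounded (range (\<lambda>z. onorm (h' z)))"
  shows "\<exists>L\<ge>0. \<forall>y z. \<bar>h y - h z\<bar> \<le> L * norm (y - z)"
proof -
  obtain L where L: "0 < L" "\<And>z. \<bar>onorm (h' z)\<bar> \<le> L"
    using assms(2) unfolding bounded_pos by auto
  have "\<bar>h y - h z\<bar> \<le> L * norm (y - z)" for y z
    using differentiable_bound[of UNIV h h' L y z] assms(1) L(2)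
    by (simp add: abs_le_iff)
  then show ?thesis
    using L(1) by (intro exI[of _ L]) auto
qed

context quartic_lattice
begin

text \<open>An observable of the single site \<open>i\<close> has zero partial derivatives
  elsewhere, so the lattice sum reduces to one term.\<close>

lemma pbracket_local:
  "pbracket (\<lambda>y. f (y i)) h x = dq i (\<lambda>y. f (y i)) x * dp i h x - dp i (\<lambda>y. f (y i)) x * dq i h x"
proof -
  have "pbracket (\<lambda>y. f (y i)) h x
      = infsum (\<lambda>k. dq k (\<lambda>y. f (y i)) x * dp k h x - dp k (\<lambda>y. f (y i)) x * dq k h x) {i}"
    unfolding pbracket_def by (rule infsum_cong_neutral) (auto simp: dq_def dp_def)
  then show ?thesis
    by simp
qed

text \<open>The partial derivatives of \<open>g (\<Phi> t y j)\<close> in site \<open>i\<close> are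
  limits of difference quotients, which \<open>variation_bound\<close> controls after composition
  with the Lipschitz function \<open>g\<close>; the linearised equations never appear.\<close>

lemma pbracket_bound:
  fixes f g :: "real \<times> real \<Rightarrow> real"
  assumes f: "\<forall>z. (f has_derivative f' z) (at z)" "bounded (range (\<lambda>z. onorm (f' z)))"
    and g: "\<forall>z. (g has_derivative g' z) (at z)" "bounded (range (\<lambda>z. onorm (g' z)))"
    and x: "x \<in> phase_space" and "0 \<le> A"
    and A: "\<And>t \<tau> k. 0 \<le> \<tau> \<Longrightarrow> \<tau> \<le> t \<Longrightarrow> (fst (\<Phi> \<tau> x k))\<^sup>2 \<le> A * lw t k"
  shows "\<exists>L\<ge>0. \<exists>C\<ge>0. \<forall>t j. 0 \<le> t \<longrightarrow>
    \<bar>pbracket (\<lambda>y. f (y i)) (\<lambda>y. g (\<Phi> t y j)) x\<bar> \<le> L * exp (- 3 / 2 * rnorm (i - j) + t * (C * lw t i + C))"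
proof -
  obtain C where "0 \<le> C" and C: "\<And>t j. 0 \<le> t \<Longrightarrow> \<exists>\<sigma>>0. \<forall>z. norm (z - x i) < \<sigma> \<longrightarrow>
      norm (\<Phi> t (x(i := z)) j - \<Phi> t x j) \<le> norm (z - x i) * exp (- 3 / 2 * rnorm (i - j) + t * (C * lw t i + C))"
    using variation_bound[OF \<open>0 \<le> A\<close>] x A by metis
  obtain Lf where "0 \<le> Lf" and Lf: "\<And>y z. \<bar>f y - f z\<bar> \<le> Lf * norm (y - z)"
    using bounded_derivative_lipschitz[OF f] by blast
  obtain Lg where "0 \<le> Lg" and Lg: "\<And>y z. \<bar>g y - g z\<bar> \<le> Lg * norm (y - z)"
    using bounded_derivative_lipschitz[OF g] by blast
  have diff_comp: "(\<lambda>s. h (w s)) differentiable (at s)"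
    if "\<forall>z. (h has_derivative h' z) (at z)" "w differentiable (at s)"
    for h :: "real \<times> real \<Rightarrow> real" and h' and w :: "real \<Rightarrow> real \<times> real" and s
    using that has_derivative_compose unfolding differentiable_def by blast
  define q p where "q s = (s, snd (x i))" and "p s = (fst (x i), s)" for s :: real
  have qp: "q differentiable (at s)" "p differentiable (at s)" for s
    unfolding q_def[abs_def] p_def[abs_def] differentiable_def
    by (auto intro!: exI derivative_intros)
  have norm_q: "norm (q s - x i) = \<bar>s - fst (x i)\<bar>" and norm_p: "norm (p s - x i) = \<bar>s - snd (x i)\<bar>" for s
    by (simp_all add: q_def p_def norm_prod_def)
  have q0: "q (fst (x i)) = x i" and p0: "p (snd (x i)) = x i"
    by (simp_all add: q_def p_def)
  have df: "\<bar>dq i (\<lambda>y. f (y i)) x\<bar> \<le> Lf" "\<bar>dp i (\<lambda>y. f (y i)) x\<bar> \<le> Lf"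
    unfolding dq_def dp_def fun_upd_same q_def[symmetric] p_def[symmetric]
    by (rule abs_deriv_le[where \<sigma> = 1, OF diff_comp[OF f(1) qp(1)]], simp,
        metis Lf norm_q q0, rule abs_deriv_le[where \<sigma> = 1, OF diff_comp[OF f(1) qp(2)]], simp,
        metis Lf norm_p p0)
  have "\<bar>pbracket (\<lambda>y. f (y i)) (\<lambda>y. g (\<Phi> t y j)) x\<bar>
      \<le> 2 * Lf * Lg * exp (- 3 / 2 * rnorm (i - j) + t * (C * lw t i + C))" if "0 \<le> t" for t j
  proof -
    define E where "E = exp (- 3 / 2 * rnorm (i - j) + t * (C * lw t i + C))"
    obtain \<sigma> where "0 < \<sigma>" and \<sigma>: "\<And>z. norm (z - x i) < \<sigma> \<Longrightarrow>
        norm (\<Phi> t (x(i := z)) j - \<Phi> t x j) \<le> norm (z - x i) * E"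
      using C[OF \<open>0 \<le> t\<close>] unfolding E_def by blast
    have g\<sigma>: "\<bar>g (\<Phi> t (x(i := z)) j) - g (\<Phi> t x j)\<bar> \<le> Lg * E * norm (z - x i)"
      if "norm (z - x i) < \<sigma>" for z
      using order_trans[OF Lg mult_left_mono[OF \<sigma>[OF that] \<open>0 \<le> Lg\<close>]] by (simp add: mult_ac)
    have flow_diff: "(\<lambda>s. \<Phi> t (x(i := q s)) j) differentiable (at s)"
      "(\<lambda>s. \<Phi> t (x(i := p s)) j) differentiable (at s)" for s
      using flow x unfolding is_flow_def q_def p_def by blast+
    have dg: "\<bar>dq i (\<lambda>y. g (\<Phi> t y j)) x\<bar> \<le> Lg * E" "\<bar>dp i (\<lambda>y. g (\<Phi> t y j)) x\<bar> \<le> Lg * E"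
    proof -
      show "\<bar>dq i (\<lambda>y. g (\<Phi> t y j)) x\<bar> \<le> Lg * E"
        unfolding dq_def q_def[symmetric]
      proof (rule abs_deriv_le[OF diff_comp[OF g(1) flow_diff(1)] \<open>0 < \<sigma>\<close>])
        show "\<bar>g (\<Phi> t (x(i := q y)) j) - g (\<Phi> t (x(i := q (fst (x i)))) j)\<bar> \<le> Lg * E * \<bar>y - fst (x i)\<bar>"
          if "\<bar>y - fst (x i)\<bar> < \<sigma>" for y
          using g\<sigma>[of "q y"] that by (simp add: norm_q q0)
      qed
      show "\<bar>dp i (\<lambda>y. g (\<Phi> t y j)) x\<bar> \<le> Lg * E"
        unfolding dp_def p_def[symmetric]
      proof (rule abs_deriv_le[OF diff_comp[OF g(1) flow_diff(2)] \<open>0 < \<sigma>\<close>])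
        show "\<bar>g (\<Phi> t (x(i := p y)) j) - g (\<Phi> t (x(i := p (snd (x i)))) j)\<bar> \<le> Lg * E * \<bar>y - snd (x i)\<bar>"
          if "\<bar>y - snd (x i)\<bar> < \<sigma>" for y
          using g\<sigma>[of "p y"] that by (simp add: norm_p p0)
      qed
    qed
    have "\<bar>a * d - b * c\<bar> \<le> 2 * Lf * (Lg * E)"
      if "\<bar>a\<bar> \<le> Lf" "\<bar>b\<bar> \<le> Lf" "\<bar>c\<bar> \<le> Lg * E" "\<bar>d\<bar> \<le> Lg * E" for a b c d
    proof -
      have "\<bar>a * d\<bar> \<le> Lf * (Lg * E)" "\<bar>b * c\<bar> \<le> Lf * (Lg * E)"
        unfolding abs_mult using that \<open>0 \<le> Lf\<close> by (intro mult_mono; simp)+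
      then show ?thesis
        by linarith
    qed
    from this[OF df dg] show ?thesis
      by (simp add: pbracket_local E_def)
  qed
  moreover have "0 \<le> 2 * Lf * Lg"
    using \<open>0 \<le> Lf\<close> \<open>0 \<le> Lg\<close> by simp
  ultimately show ?thesis
    using \<open>0 \<le> C\<close> by blast
qed

lemma pbracket_light_cone:
  fixes f g :: "real \<times> real \<Rightarrow> real"
  assumes f: "\<forall>z. (f has_derivative f' z) (at z)" "bounded (range (\<lambda>z. onorm (f' z)))"
    and g: "\<forall>z. (g has_derivative g' z) (at z)" "bounded (range (\<lambda>z. onorm (g' z)))"
    and x: "x \<in> phase_space" and B: "\<And>(m :: nat) k. site_en (\<Phi> (real m) x) k \<le> B * lnw (real m) k"
    and "1 / 2 < \<alpha>"
  shows "((\<lambda>t. SUP j \<in> {j. real_of_int (ldist i j) > t * (ln t) powr \<alpha>}.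
      ereal (exp (b * t) * pbracket (\<lambda>y. f (y i)) (\<lambda>y. g (\<Phi> t y j)) x)) \<longlongrightarrow> 0) at_top"
proof -
  obtain A where "0 \<le> A" and A: "\<And>t \<tau> k. 0 \<le> \<tau> \<Longrightarrow> \<tau> \<le> t \<Longrightarrow> (fst (\<Phi> \<tau> x k))\<^sup>2 \<le> A * lw t k"
    using orbit_bound[OF x B] by blast
  obtain L C where "0 \<le> L" "0 \<le> C" and LC: "\<And>t j. 0 \<le> t \<Longrightarrow>
      \<bar>pbracket (\<lambda>y. f (y i)) (\<lambda>y. g (\<Phi> t y j)) x\<bar> \<le> L * exp (- 3 / 2 * rnorm (i - j) + t * (C * lw t i + C))"
    using pbracket_bound[OF f g x \<open>0 \<le> A\<close> A] by blast
  define n where "n = rnorm i"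
  have "0 \<le> n"
    by (simp add: n_def)
  define J where "J t = {j. real_of_int (ldist i j) > t * (ln t) powr \<alpha>}" for t
  define F where "F t j = exp (b * t) * pbracket (\<lambda>y. f (y i)) (\<lambda>y. g (\<Phi> t y j)) x" for t j
  \<comment> \<open>As \<open>\<alpha> > 1 / 2\<close>, the last term dominates the square root of
    the logarithm and every constant, so the exponent tends to minus infinity. The threshold matters
    only here.\<close>
  define h where "h t = L * exp (t * (b + C + C * sqrt (ln (exp 1 + t + n)) - 3 / 2 * (ln t) powr \<alpha>))" for t
  have h: "(h \<longlongrightarrow> 0) at_top"
    unfolding h_def using \<open>1 / 2 < \<alpha>\<close> \<open>0 \<le> C\<close> \<open>0 \<le> n\<close> by real_asymp
  have bound: "\<bar>F t j\<bar> \<le> h t" if "0 \<le> t" "j \<in> J t" for t j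
  proof -
    have "t * (ln t) powr \<alpha> \<le> rnorm (i - j)"
      using that(2) by (simp add: J_def ldist_def rnorm_def)
    then have "exp (b * t) * exp (- 3 / 2 * rnorm (i - j) + t * (C * lw t i + C))
        \<le> exp (t * (b + C + C * sqrt (ln (exp 1 + t + n)) - 3 / 2 * (ln t) powr \<alpha>))"
      by (simp add: lw_def n_def algebra_simps flip: exp_add)
    then have "L * (exp (b * t) * exp (- 3 / 2 * rnorm (i - j) + t * (C * lw t i + C))) \<le> h t"
      unfolding h_def using \<open>0 \<le> L\<close> by (rule mult_left_mono)
    moreover have "\<bar>F t j\<bar> \<le> exp (b * t) * (L * exp (- 3 / 2 * rnorm (i - j) + t * (C * lw t i + C)))"
      unfolding F_def abs_mult abs_exp_cancel using LC[OF that(1)] by (intro mult_left_mono) auto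
    ultimately show ?thesis
      by (simp add: mult_ac)
  qed
  \<comment> \<open>Over the empty set the supremum in \<open>ereal\<close> would be minus infinity,
    so the lower bound needs a site outside the cone; shifting all coordinates of \<open>i\<close>
    by \<open>m\<close> gives one.\<close>
  have nonempty: "J t \<noteq> {}" for t
  proof -
    define m where "m = nat \<lceil>t * (ln t) powr \<alpha>\<rceil> + 1"
    define j where "j = i + (\<chi> _. int m)"
    have "t * (ln t) powr \<alpha> < real m"
      unfolding m_def by linarith
    also have "real m \<le> rnorm (j - i)"
      using rnorm_component_le[of "j - i" undefined] by (simp add: j_def)
    finally have "j \<in> J t"
      by (simp add: J_def ldist_def rnorm_def lnorm_minus_commute)
    then show ?thesis by blast
  qed
  have "((\<lambda>t. SUP j\<in>J t. ereal (F t j)) \<longlongrightarrow> 0) at_top"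
  proof (rule tendsto_sandwich)
    have "((\<lambda>t. ereal (- h t)) \<longlongrightarrow> ereal (- 0)) at_top" "((\<lambda>t. ereal (h t)) \<longlongrightarrow> ereal 0) at_top"
      by (intro tendsto_intros h)+
    then show "((\<lambda>t. ereal (- h t)) \<longlongrightarrow> 0) at_top" "((\<lambda>t. ereal (h t)) \<longlongrightarrow> 0) at_top"
      by (simp_all add: zero_ereal_def)
    show "\<forall>\<^sub>F t in at_top. ereal (- h t) \<le> (SUP j\<in>J t. ereal (F t j))"
      using eventually_ge_at_top[of 0]
    proof eventually_elim
      case (elim t)
      obtain j where j: "j \<in> J t"
        using nonempty by blast
      then have "ereal (- h t) \<le> ereal (F t j)"
        using bound[OF elim j] by simp
      then show ?case
        using j by (rule SUP_upper2[rotated])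
    qed
    show "\<forall>\<^sub>F t in at_top. (SUP j\<in>J t. ereal (F t j)) \<le> ereal (h t)"
      using eventually_ge_at_top[of 0]
    proof eventually_elim
      case (elim t)
      show ?case
        using bound[OF elim] by (intro SUP_least) (simp add: abs_le_iff)
    qed
  qed
  then show ?thesis
    by (simp add: J_def F_def)
qed

end

section \<open>Almost sure bounds\<close>

text \<open>A first moment argument in place of Borel-Cantelli: the sum over the family has finite
  expectation, so it is almost surely finite, and it bounds each of its terms.\<close>

lemma AE_countable_family_bounded:
  fixes Z :: "'i::countable \<Rightarrow> 'a \<Rightarrow> ennreal"
  assumes meas: "\<And>n. Z n \<in> borel_measurable M"
    and sum_le: "\<And>F. finite F \<Longrightarrow> (\<Sum>n\<in>F. \<integral>\<^sup>+x. Z n x \<partial>M) \<le> ennreal S"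
  shows "AE x in M. \<exists>B. \<forall>n. Z n x \<le> ennreal B"
proof -
  \<comment> \<open>The family is indexed by naturals through \<open>to_nat\<close>, with zero at
    numbers that encode nothing.\<close>
  define f where "f n x = (if n \<in> range (to_nat :: 'i \<Rightarrow> nat) then Z (from_nat n) x else 0)" for n x
  have f_meas[measurable]: "f n \<in> borel_measurable M" for n
    unfolding f_def using meas by simp
  have "(\<integral>\<^sup>+x. (\<Sum>n. f n x) \<partial>M) = (\<Sum>n. \<integral>\<^sup>+x. f n x \<partial>M)"
    by (rule nn_integral_suminf) simp
  also have "\<dots> \<le> ennreal S"
  proof (rule suminf_le_const[OF summableI])
    fix N
    define F where "F = (from_nat :: nat \<Rightarrow> 'i) ` ({..<N} \<inter> range (to_nat :: 'i \<Rightarrow> nat))"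
    have "(\<Sum>n<N. \<integral>\<^sup>+x. f n x \<partial>M) = (\<Sum>n\<in>{..<N} \<inter> range (to_nat :: 'i \<Rightarrow> nat). \<integral>\<^sup>+x. Z (from_nat n) x \<partial>M)"
      by (rule sum.mono_neutral_cong_right) (auto simp: f_def)
    also have "\<dots> = (\<Sum>i\<in>F. \<integral>\<^sup>+x. Z i x \<partial>M)"
      unfolding F_def by (subst sum.reindex) (auto intro!: inj_onI)
    also have "\<dots> \<le> ennreal S"
      by (rule sum_le) (simp add: F_def)
    finally show "(\<Sum>n<N. \<integral>\<^sup>+x. f n x \<partial>M) \<le> ennreal S" .
  qed
  also have "\<dots> < \<infinity>"
    by simp
  finally have "AE x in M. (\<Sum>n. f n x) \<noteq> \<infinity>"
    by (intro nn_integral_PInf_AE) auto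
  then show ?thesis
  proof eventually_elim
    case (elim x)
    have "Z i x \<le> ennreal (enn2real (\<Sum>n. f n x))" for i
    proof -
      have "Z i x = (\<Sum>n\<in>{to_nat i}. f n x)"
        by (simp add: f_def)
      also have "\<dots> \<le> (\<Sum>n. f n x)"
        by (rule sum_le_suminf[OF summableI]) auto
      also have "\<dots> = ennreal (enn2real (\<Sum>n. f n x))"
        using elim by (simp add: less_top)
      finally show ?thesis .
    qed
    then show ?case by blast
  qed
qed

text \<open>The weights are summable over time and space jointly, yet only polynomially small, so
  that undoing them inside an exponential moment costs only a logarithm.\<close>

lemma sum_space_time_le:
  fixes F :: "(nat \<times> (int ^ 'd::finite)) set"
  assumes "finite F"
  shows "(\<Sum>(m, k)\<in>F. inverse ((1 + real m)\<^sup>2) * inverse ((1 + rnorm k) ^ (2 * CARD('d)))) \<le> 4 * 4 ^ CARD('d)"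
proof -
  let ?a = "\<lambda>m. inverse ((1 + real m)\<^sup>2)" and ?b = "\<lambda>k :: int ^ 'd. inverse ((1 + rnorm k) ^ (2 * CARD('d)))"
  have a: "sum ?a H \<le> 4" if "finite H" for H
  proof -
    have "sum ?a H = (\<Sum>m\<in>int ` H. inverse ((1 + \<bar>real_of_int m\<bar>)\<^sup>2))"
      by (simp add: sum.reindex)
    then show ?thesis
      using sum_inverse_squares_int_le[of "int ` H"] that by simp
  qed
  have b: "sum ?b H \<le> 4 ^ CARD('d)" if "finite H" for H
    using sum_lattice_inverse_powers_le[OF that, of 0] by simp
  have "(\<Sum>(m, k)\<in>F. ?a m * ?b k) \<le> (\<Sum>(m, k)\<in>fst ` F \<times> snd ` F. ?a m * ?b k)"
    using assms by (intro sum_mono2) (auto intro!: mult_nonneg_nonneg simp: rev_image_eqI)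
  also have "\<dots> = sum ?a (fst ` F) * sum ?b (snd ` F)"
    by (simp add: sum_product sum.cartesian_product)
  also have "\<dots> \<le> 4 * 4 ^ CARD('d)"
    using assms by (intro mult_mono a b) (auto intro!: sum_nonneg)
  finally show ?thesis .
qed

lemma local_obs_site:
  fixes \<psi> :: "real \<times> real \<Rightarrow> real" and k :: "int ^ 'd::finite"
  assumes deriv: "\<And>z. (\<psi> has_derivative (\<lambda>v. inner (G z) v)) (at z)"
    and "\<And>z. \<bar>\<psi> z\<bar> \<le> B" "\<And>z. norm (G z) \<le> B"
  shows "local_obs (\<lambda>x. \<psi> (x k))"
  unfolding local_obs_def
proof (intro exI[of _ "{k}"] conjI)
  have "\<exists>\<delta>>0. \<forall>y. (\<forall>i. i \<notin> {k} \<longrightarrow> y i = x i) \<and> (\<Sum>i\<in>{k}. norm (y i - x i)) < \<delta> \<longrightarrow>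
      \<bar>\<psi> (y k) - \<psi> (x k) - (\<Sum>i\<in>{k}. inner (G (x k)) (y i - x i))\<bar> \<le> \<epsilon> * (\<Sum>i\<in>{k}. norm (y i - x i))"
    if \<epsilon>: "0 < \<epsilon>" for x :: "'d cfg" and \<epsilon>
  proof -
    obtain \<delta> where "0 < \<delta>" and "\<And>z. norm (z - x k) < \<delta> \<Longrightarrow>
        norm (\<psi> z - \<psi> (x k) - inner (G (x k)) (z - x k)) \<le> \<epsilon> * norm (z - x k)"
      using deriv[of "x k"] \<epsilon> unfolding has_derivative_at_alt by blast
    then show ?thesis
      by (intro exI[of _ \<delta>]) auto
  qed
  then show "\<exists>D B. \<forall>x. \<bar>\<psi> (x k)\<bar> \<le> B \<and> (\<forall>i\<in>{k}. norm (D x i) \<le> B) \<and>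
      (\<forall>\<epsilon>>0. \<exists>\<delta>>0. \<forall>y. (\<forall>i. i \<notin> {k} \<longrightarrow> y i = x i) \<and> (\<Sum>i\<in>{k}. norm (y i - x i)) < \<delta> \<longrightarrow>
        \<bar>\<psi> (y k) - \<psi> (x k) - (\<Sum>i\<in>{k}. inner (D x i) (y i - x i))\<bar> \<le> \<epsilon> * (\<Sum>i\<in>{k}. norm (y i - x i)))"
    using assms(2,3) by (intro exI[of _ "\<lambda>x _. G (x k)"] exI[of _ B]) blast
qed auto

section \<open>Exponential moments along the flow\<close>

context quartic_lattice
begin

lemma continuous_site_en: "continuous_on UNIV (\<lambda>x. site_en x k)"
  unfolding site_en_def by (intro continuous_intros continuous_on_product_coordinates) auto

lemma continuous_Wloc: "continuous_on UNIV (\<lambda>x. Wloc (poly P) K \<nu> n x)"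
  unfolding Wloc_def case_prod_beta by (intro continuous_intros continuous_on_product_coordinates) auto

text \<open>A bounded approximation of \<open>exp (lam * site_en x k)\<close> from below. Its
  gradient stays bounded because the gradient of the energy is at most a multiple of the energy,
  which the factor \<open>exp (- lam * site_en x k)\<close> absorbs.\<close>

lemma local_obs_site_en:
  assumes "0 < lam" "0 < \<epsilon>"
  shows "local_obs (\<lambda>x. 1 / (exp (- lam * site_en x k) + \<epsilon>))"
proof -
  obtain C4 where C4: "1 \<le> C4" "\<And>q. q ^ 4 \<le> C4 * (poly P q + 1)"
    using quartic_lower_bound[OF degree_P lead_coeff_P P_nonneg] by blast
  obtain C' where C': "0 \<le> C'" "\<And>q. \<bar>poly (pderiv P) q\<bar> \<le> C' * (1 + q ^ 4)"
    using quartic_deriv_bound[OF degree_P] by blast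
  define e where "e z = (snd z)\<^sup>2 / 2 + poly P (fst z) + 1" for z :: "real \<times> real"
  define E where "E z = exp (- lam * e z)" for z
  define G where "G z = (lam * E z / (E z + \<epsilon>)\<^sup>2) *\<^sub>R (poly (pderiv P) (fst z), snd z)" for z
  define c where "c = C' * (1 + C4) + 3"
  have "0 \<le> c"
    using C' C4 by (simp add: c_def)
  have E: "0 < E z" for z
    by (simp add: E_def)
  have e1: "1 \<le> e z" for z
    using P_nonneg by (simp add: e_def)
  have grad_le: "norm (poly (pderiv P) (fst z), snd z) \<le> c * e z" for z
  proof -
    have "poly P (fst z) + 1 \<le> e z"
      by (simp add: e_def)
    then have "fst z ^ 4 \<le> C4 * e z"
      using C4 by (meson mult_left_mono order_trans zero_le_one)
    then have "1 + fst z ^ 4 \<le> (1 + C4) * e z"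
      using e1[of z] by (simp add: algebra_simps)
    then have "C' * (1 + fst z ^ 4) \<le> C' * ((1 + C4) * e z)"
      using C'(1) by (rule mult_left_mono)
    moreover have "\<bar>snd z\<bar> \<le> 1 + (snd z)\<^sup>2"
      using zero_le_power2[of "\<bar>snd z\<bar> - 1"] zero_le_power2[of "snd z"] by (simp add: power2_diff)
    moreover have "(snd z)\<^sup>2 \<le> 2 * e z"
      using P_nonneg[rule_format, of "fst z"] by (simp add: e_def)
    moreover have "norm (poly (pderiv P) (fst z), snd z) \<le> \<bar>poly (pderiv P) (fst z)\<bar> + \<bar>snd z\<bar>"
      using norm_Pair_le[of "poly (pderiv P) (fst z)" "snd z"] by simp
    ultimately show ?thesis
      using C'(2)[of "fst z"] e1[of z] unfolding c_def distrib_right mult.assoc by linarith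
  qed
  have "local_obs (\<lambda>x. 1 / (E (x k) + \<epsilon>))"
  proof (rule local_obs_site[where G = G and B = "1 / \<epsilon> + c / \<epsilon>\<^sup>2"])
    fix z
    have pos: "E z + \<epsilon> \<noteq> 0"
      using E[of z] \<open>0 < \<epsilon>\<close> by linarith
    have De: "(e has_derivative (\<lambda>v. inner (poly (pderiv P) (fst z), snd z) v)) (at z)"
      unfolding e_def
      by (auto intro!: derivative_eq_intros has_derivative_compose[OF has_derivative_fst poly_DERIV[unfolded has_field_derivative_def]]
          simp: inner_prod_def fun_eq_iff)
    have DE: "(E has_derivative (\<lambda>v. - lam * inner (poly (pderiv P) (fst z), snd z) v * E z)) (at z)"
      unfolding E_def by (auto intro!: derivative_eq_intros De simp: fun_eq_iff)
    have "((\<lambda>z. 1 / (E z + \<epsilon>)) has_derivative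
        (\<lambda>v. - (- lam * inner (poly (pderiv P) (fst z), snd z) v * E z) / (E z + \<epsilon>)\<^sup>2)) (at z)"
      using pos by (auto intro!: derivative_eq_intros DE simp: fun_eq_iff power2_eq_square divide_simps)
    then show "((\<lambda>z. 1 / (E z + \<epsilon>)) has_derivative (\<lambda>v. inner (G z) v)) (at z)"
      by (rule has_derivative_eq_rhs) (simp add: G_def fun_eq_iff add_divide_distrib algebra_simps)
    have "1 / (E z + \<epsilon>) \<le> 1 / \<epsilon>"
      using E[of z] \<open>0 < \<epsilon>\<close> by (intro divide_left_mono) auto
    then show "\<bar>1 / (E z + \<epsilon>)\<bar> \<le> 1 / \<epsilon> + c / \<epsilon>\<^sup>2"
      using E[of z] \<open>0 < \<epsilon>\<close> \<open>0 \<le> c\<close> by (simp add: add_increasing2)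
    have "norm (G z) = lam * E z / (E z + \<epsilon>)\<^sup>2 * norm (poly (pderiv P) (fst z), snd z)"
      unfolding G_def norm_scaleR using E[of z] \<open>0 < lam\<close> by simp
    also have "\<dots> \<le> lam * E z / \<epsilon>\<^sup>2 * (c * e z)"
      using E[of z] \<open>0 < \<epsilon>\<close> \<open>0 < lam\<close> grad_le[of z]
      by (intro mult_mono divide_left_mono power_mono) auto
    also have "\<dots> = c / \<epsilon>\<^sup>2 * (lam * e z * exp (- (lam * e z)))"
      by (simp add: E_def)
    also have "\<dots> \<le> c / \<epsilon>\<^sup>2 * 1"
    proof (rule mult_left_mono)
      have "lam * e z \<le> exp (lam * e z)"
        using exp_ge_add_one_self[of "lam * e z"] by linarith
      then show "lam * e z * exp (- (lam * e z)) \<le> 1"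
        by (simp add: exp_minus divide_simps)
    qed (use \<open>0 \<le> c\<close> in simp)
    finally show "norm (G z) \<le> 1 / \<epsilon> + c / \<epsilon>\<^sup>2"
      using \<open>0 < \<epsilon>\<close> by (simp add: add_increasing)
  qed
  then show ?thesis
    by (simp add: E_def e_def site_en_def)
qed

text \<open>
  Invariance says nothing about measurability of \<open>h \<circ> \<Phi> t\<close>; it follows since a nonzero Bochner
  integral forces integrability.
\<close>

lemma invariant_local_obs:
  assumes state: "time_invariant_state (poly P) K \<Phi> \<omega>" and "local_obs h"
    and meas: "h \<in> borel_measurable \<omega>" and "0 < c" and h: "\<And>x. c \<le> h x" "\<And>x. h x \<le> B"
  shows "(\<lambda>x. h (\<Phi> t x)) \<in> borel_measurable \<omega>"
    and "(\<integral>\<^sup>+x. ennreal (h (\<Phi> t x)) \<partial>\<omega>) = (\<integral>\<^sup>+x. ennreal (h x) \<partial>\<omega>)"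
proof -
  interpret prob_space \<omega>
    using state by (simp add: time_invariant_state_def)
  have nonneg: "0 \<le> h x" for x
    using h(1)[of x] \<open>0 < c\<close> by linarith
  have int: "integrable \<omega> h"
    using h(2) nonneg meas by (intro integrable_const_bound[where B = B]) auto
  have "c = (\<integral>x. c \<partial>\<omega>)"
    by (simp add: prob_space)
  also have "\<dots> \<le> (\<integral>x. h x \<partial>\<omega>)"
    using int h(1) by (intro integral_mono) auto
  finally have pos: "0 < (\<integral>x. h x \<partial>\<omega>)"
    using \<open>0 < c\<close> by linarith
  have eq: "(\<integral>x. h (\<Phi> t x) \<partial>\<omega>) = (\<integral>x. h x \<partial>\<omega>)"
    using state \<open>local_obs h\<close> by (simp add: time_invariant_state_def)
  then have int': "integrable \<omega> (\<lambda>x. h (\<Phi> t x))"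
    using pos not_integrable_integral_eq by fastforce
  then show "(\<lambda>x. h (\<Phi> t x)) \<in> borel_measurable \<omega>"
    by simp
  show "(\<integral>\<^sup>+x. ennreal (h (\<Phi> t x)) \<partial>\<omega>) = (\<integral>\<^sup>+x. ennreal (h x) \<partial>\<omega>)"
    using int int' nonneg eq by (simp add: nn_integral_eq_integral)
qed

text \<open>Fatou's lemma along bounded approximations, each with an invariant integral below the
  exponential moment. Measurability along the flow passes to the limit in the same way.\<close>

lemma exp_site_en_moment:
  assumes state: "time_invariant_state (poly P) K \<Phi> \<omega>" and "0 < lam"
    and moment: "(\<integral>\<^sup>+x. ennreal (exp (lam * site_en x k)) \<partial>\<omega>) \<le> M"
  shows "(\<lambda>x. ennreal (exp (lam * site_en (\<Phi> t x) k))) \<in> borel_measurable \<omega>"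
    and "(\<integral>\<^sup>+x. ennreal (exp (lam * site_en (\<Phi> t x) k)) \<partial>\<omega>) \<le> M"
proof -
  have sets: "sets \<omega> = sets borel"
    using state by (simp add: time_invariant_state_def)
  define h where "h n x = 1 / (exp (- lam * site_en x k) + inverse (real (Suc n)))" for n x
  have pos: "0 < exp (- lam * site_en x k) + inverse (real (Suc n))" for n x
    by (simp add: add_pos_pos)
  have h_meas: "h n \<in> borel_measurable \<omega>" for n
  proof -
    have "continuous_on UNIV (h n)"
      unfolding h_def using pos by (intro continuous_intros continuous_site_en) (simp add: less_imp_neq[symmetric])
    then show ?thesis
      unfolding measurable_cong_sets[OF sets refl] by (rule borel_measurable_continuous_onI)
  qed
  \<comment> \<open>A positive lower bound makes the integral nonzero, the condition under which
    invariance forces integrability.\<close>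
  have h_lower: "1 / 2 \<le> h n x" for n x
  proof -
    have "exp (- lam * site_en x k) \<le> 1" "inverse (real (Suc n)) \<le> 1"
      using \<open>0 < lam\<close> site_en_ge_1[of x k] by (auto simp: inverse_le_1_iff)
    then have "exp (- lam * site_en x k) + inverse (real (Suc n)) \<le> 2"
      by linarith
    moreover have "1 / 2 \<le> 1 / d" if "0 < d" "d \<le> 2" for d :: real
      using that by (simp add: field_simps)
    ultimately show ?thesis
      unfolding h_def using pos by blast
  qed
  have h_upper: "h n x \<le> real (Suc n)" for n x
  proof -
    have "h n x \<le> 1 / inverse (real (Suc n))"
      unfolding h_def by (intro divide_left_mono) (auto intro!: mult_pos_pos add_pos_pos)
    then show ?thesis
      by (simp add: inverse_eq_divide)
  qed
  have h_le: "h n x \<le> exp (lam * site_en x k)" for n x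
  proof -
    have "h n x \<le> 1 / exp (- lam * site_en x k)"
      unfolding h_def by (intro divide_left_mono) (auto intro!: mult_pos_pos add_pos_pos)
    then show ?thesis
      by (simp add: exp_minus inverse_eq_divide)
  qed
  have h_local: "local_obs (h n)" for n
    unfolding h_def using \<open>0 < lam\<close> by (intro local_obs_site_en) auto
  note inv = invariant_local_obs[OF state h_local h_meas _ h_lower h_upper]
  have "(\<lambda>n. h n y) \<longlonglongrightarrow> 1 / (exp (- lam * site_en y k) + 0)" for y
    unfolding h_def by (intro tendsto_intros LIMSEQ_inverse_real_of_nat) simp
  then have lim: "(\<lambda>n. ennreal (h n y)) \<longlonglongrightarrow> ennreal (exp (lam * site_en y k))" for y
    by (intro tendsto_ennrealI) (simp add: exp_minus divide_simps)
  have lim_meas: "(\<lambda>x. ennreal (h n (\<Phi> t x))) \<in> borel_measurable \<omega>" for n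
    using inv(1) by simp
  show "(\<lambda>x. ennreal (exp (lam * site_en (\<Phi> t x) k))) \<in> borel_measurable \<omega>"
    by (rule borel_measurable_LIMSEQ_order[OF _ lim_meas]) (rule lim)
  have "(\<integral>\<^sup>+x. ennreal (exp (lam * site_en (\<Phi> t x) k)) \<partial>\<omega>)
      = (\<integral>\<^sup>+x. liminf (\<lambda>n. ennreal (h n (\<Phi> t x))) \<partial>\<omega>)"
    using lim by (intro nn_integral_cong) (metis lim_imp_Liminf trivial_limit_sequentially)
  also have "\<dots> \<le> liminf (\<lambda>n. \<integral>\<^sup>+x. ennreal (h n (\<Phi> t x)) \<partial>\<omega>)"
    by (rule nn_integral_liminf[OF lim_meas])
  also have "\<dots> \<le> liminf (\<lambda>n. M)"
  proof (intro Liminf_mono always_eventually allI)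
    fix n
    have "(\<integral>\<^sup>+x. ennreal (h n (\<Phi> t x)) \<partial>\<omega>) = (\<integral>\<^sup>+x. ennreal (h n x) \<partial>\<omega>)"
      by (rule inv(2)) simp
    also have "\<dots> \<le> (\<integral>\<^sup>+x. ennreal (exp (lam * site_en x k)) \<partial>\<omega>)"
      using h_le by (intro nn_integral_mono ennreal_leI)
    finally show "(\<integral>\<^sup>+x. ennreal (h n (\<Phi> t x)) \<partial>\<omega>) \<le> M"
      using moment by (rule order_trans)
  qed
  also have "\<dots> = M"
    by (simp add: Liminf_const)
  finally show "(\<integral>\<^sup>+x. ennreal (exp (lam * site_en (\<Phi> t x) k)) \<partial>\<omega>) \<le> M" .
qed

text \<open>The moments of all sites at all integer times share one bound; a polynomial weight in
  \<open>m\<close> and \<open>k\<close> makes them summable, and taking logarithms turns that weight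
  into \<open>lnw (real m) k\<close>.\<close>

lemma AE_site_en_bound:
  assumes state: "time_invariant_state (poly P) K \<Phi> \<omega>"
  shows "AE x in \<omega>. \<exists>B. \<forall>(m :: nat) k. site_en (\<Phi> (real m) x) k \<le> B * lnw (real m) k"
proof -
  obtain C lam where "0 < lam" and moment: "\<And>\<nu> n. (\<integral>\<^sup>+ x. ennreal (exp (lam * Wloc (poly P) K \<nu> n x)) \<partial>\<omega>)
          \<le> ennreal (exp (C * (2 * real n + 1) ^ CARD('d)))"
    using state unfolding time_invariant_state_def by (metis order_refl)
  \<comment> \<open>A cube of radius 0 is a single site, with a moment bound independent of the
    site.\<close>
  have moment0: "(\<integral>\<^sup>+ x. ennreal (exp (lam * site_en x k)) \<partial>\<omega>) \<le> ennreal (exp C)" for k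
  proof -
    have "(\<integral>\<^sup>+ x. ennreal (exp (lam * site_en x k)) \<partial>\<omega>) \<le> (\<integral>\<^sup>+ x. ennreal (exp (lam * Wloc (poly P) K k 0 x)) \<partial>\<omega>)"
      using \<open>0 < lam\<close> site_en_le_Wloc by (intro nn_integral_mono ennreal_leI) auto
    also have "\<dots> \<le> ennreal (exp C)"
      using moment[of k 0] by simp
    finally show ?thesis .
  qed
  note inv = exp_site_en_moment[OF state \<open>0 < lam\<close> moment0]
  define w where "w p = inverse ((1 + real (fst p))\<^sup>2) * inverse ((1 + rnorm (snd p)) ^ (2 * CARD('d)))"
    for p :: "nat \<times> (int ^ 'd)"
  have w_nonneg: "0 \<le> w p" for p
    by (simp add: w_def)
  define Z where "Z p x = ennreal (w p) * ennreal (exp (lam * site_en (\<Phi> (real (fst p)) x) (snd p)))" for p x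
  have "AE x in \<omega>. \<exists>B. \<forall>p. Z p x \<le> ennreal B"
  proof (rule AE_countable_family_bounded[where S = "4 * 4 ^ CARD('d) * exp C"])
    show "Z p \<in> borel_measurable \<omega>" for p
      unfolding Z_def using inv(1) by measurable
    fix F :: "(nat \<times> (int ^ 'd)) set"
    assume "finite F"
    have "(\<Sum>p\<in>F. \<integral>\<^sup>+x. Z p x \<partial>\<omega>) \<le> (\<Sum>p\<in>F. ennreal (w p * exp C))"
    proof (rule sum_mono)
      fix p
      have "(\<integral>\<^sup>+x. Z p x \<partial>\<omega>) = ennreal (w p) * (\<integral>\<^sup>+x. ennreal (exp (lam * site_en (\<Phi> (real (fst p)) x) (snd p))) \<partial>\<omega>)"
        unfolding Z_def by (rule nn_integral_cmult) (rule inv(1))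
      also have "\<dots> \<le> ennreal (w p) * ennreal (exp C)"
        by (intro mult_left_mono inv(2)) simp
      finally show "(\<integral>\<^sup>+x. Z p x \<partial>\<omega>) \<le> ennreal (w p * exp C)"
        by (simp add: ennreal_mult w_nonneg)
    qed
    also have "\<dots> = ennreal ((\<Sum>p\<in>F. w p) * exp C)"
      using w_nonneg by (simp add: sum_distrib_right)
    also have "\<dots> \<le> ennreal (4 * 4 ^ CARD('d) * exp C)"
      using sum_space_time_le[OF \<open>finite F\<close>] by (intro ennreal_leI mult_right_mono) (auto simp: w_def case_prod_beta)
    finally show "(\<Sum>p\<in>F. \<integral>\<^sup>+x. Z p x \<partial>\<omega>) \<le> ennreal (4 * 4 ^ CARD('d) * exp C)" .
  qed
  then show ?thesis
  proof eventually_elim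
    case (elim x)
    then obtain B0 where B0: "\<And>p. Z p x \<le> ennreal B0"
      by blast
    \<comment> \<open>At least 1, so that \<open>ln B \<ge> 0\<close> can be absorbed into a
      multiple of \<open>ln y \<ge> 1\<close>.\<close>
    define B where "B = max 1 B0"
    have "1 \<le> B"
      by (simp add: B_def)
    have "site_en (\<Phi> (real m) x) k \<le> (ln B + (2 + 2 * real CARD('d))) / lam * lnw (real m) k" for m :: nat and k
    proof -
      let ?s = "site_en (\<Phi> (real m) x) k"
      define y where "y = exp 1 + real m + rnorm k"
      have "1 \<le> y" "1 + real m \<le> y" "1 + rnorm k \<le> y"
        using exp_ge_add_one_self[of 1] by (simp_all add: y_def add_increasing add_increasing2)
      have "Z (m, k) x \<le> ennreal B"
        using B0[of "(m, k)"] by (rule order_trans) (auto simp: B_def intro: ennreal_leI)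
      then have "w (m, k) * exp (lam * ?s) \<le> B"
        using \<open>1 \<le> B\<close> w_nonneg by (simp add: Z_def ennreal_mult[symmetric])
      then have "exp (lam * ?s) \<le> B * ((1 + real m)\<^sup>2 * (1 + rnorm k) ^ (2 * CARD('d)))"
        by (simp add: w_def divide_simps add_pos_nonneg mult_ac)
      also have "\<dots> \<le> B * (y\<^sup>2 * y ^ (2 * CARD('d)))"
        using \<open>1 \<le> B\<close> \<open>1 + real m \<le> y\<close> \<open>1 + rnorm k \<le> y\<close>
        by (intro mult_left_mono mult_mono power_mono) auto
      also have "\<dots> = B * y ^ (2 + 2 * CARD('d))"
        by (simp add: power_add power2_eq_square)
      also have "\<dots> = exp (ln B + (2 + 2 * real CARD('d)) * ln y)"
        using \<open>1 \<le> B\<close> \<open>1 \<le> y\<close> exp_of_nat_mult[of "2 + 2 * CARD('d)" "ln y"] by (simp add: exp_add)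
      finally have "lam * ?s \<le> ln B + (2 + 2 * real CARD('d)) * ln y"
        by simp
      also have "\<dots> \<le> ln B * ln y + (2 + 2 * real CARD('d)) * ln y"
        using lnw_ge_1[of "real m" k] \<open>1 \<le> B\<close> by (simp add: y_def mult_le_cancel_left1)
      finally show ?thesis
        using \<open>0 < lam\<close> by (simp add: y_def field_simps)
    qed
    then show ?case by blast
  qed
qed

text \<open>Here cubes of all admissible sizes enter. Their moment bounds grow exponentially in the
  volume, but admissibility bounds \<open>ln (e + |\<nu>|)\<close> by the volume, so a faster
  exponential weight makes them summable over all centres and sizes.\<close>

lemma AE_phase_space:
  assumes state: "time_invariant_state (poly P) K \<Phi> \<omega>"
  shows "AE x in \<omega>. x \<in> phase_space"
proof -
  have sets: "sets \<omega> = sets borel"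
    using state by (simp add: time_invariant_state_def)
  obtain C lam where "0 < C" "0 < lam" and moment: "\<And>\<nu> n. (\<integral>\<^sup>+ x. ennreal (exp (lam * Wloc (poly P) K \<nu> n x)) \<partial>\<omega>)
          \<le> ennreal (exp (C * (2 * real n + 1) ^ CARD('d)))"
    using state unfolding time_invariant_state_def by (metis order_refl)
  define I where "I = {(n, \<nu>). real n > (ln (exp 1 + real_of_int (lnorm (\<nu> :: int ^ 'd)))) powr (1 / real CARD('d))}"
  \<comment> \<open>Beyond cancelling \<open>C\<close>, two units per volume pay for the sum over
    sizes and \<open>2 * CARD('d)\<close> for the sum over centres.\<close>
  define E where "E = C + (2 + 2 * real CARD('d))"
  define V where "V n = (2 * real n + 1) ^ CARD('d)" for n
  have V: "1 + real n \<le> V n" "1 \<le> V n" for n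
  proof -
    show "1 \<le> V n"
      unfolding V_def by (rule one_le_power) simp
    have "(2 * real n + 1) ^ 1 \<le> V n"
      unfolding V_def by (intro power_increasing) auto
    then show "1 + real n \<le> V n"
      by simp
  qed
  define w where "w p = inverse ((1 + real (fst p))\<^sup>2) * inverse ((1 + rnorm (snd p)) ^ (2 * CARD('d)))"
    for p :: "nat \<times> (int ^ 'd)"
  have w_nonneg: "0 \<le> w p" for p
    by (simp add: w_def)
  have decay: "exp (- E * V n) * exp (C * V n) \<le> w (n, \<nu>)" if "(n, \<nu>) \<in> I" for n \<nu>
  proof -
    define L where "L = ln (exp 1 + rnorm \<nu>)"
    have "1 \<le> L"
      using lnw_ge_1[of 0 \<nu>] by (simp add: L_def)
    have "L = (L powr (1 / real CARD('d))) ^ CARD('d)"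
      using \<open>1 \<le> L\<close> by (simp add: powr_power)
    also have "\<dots> \<le> real n ^ CARD('d)"
      using that by (intro power_mono) (auto simp: I_def L_def rnorm_def)
    also have "\<dots> \<le> V n"
      unfolding V_def by (intro power_mono) auto
    finally have "L \<le> V n" .
    have "exp (- E * V n) * exp (C * V n) = exp (- (2 * V n)) * exp (- (2 * real CARD('d) * V n))"
      by (simp add: E_def algebra_simps flip: exp_add)
    also have "\<dots> \<le> inverse ((1 + real n)\<^sup>2) * inverse ((1 + rnorm \<nu>) ^ (2 * CARD('d)))"
    proof (rule mult_mono)
      have "1 + real n \<le> exp (V n)"
        using V(1)[of n] exp_ge_add_one_self[of "V n"] by linarith
      then have "(1 + real n)\<^sup>2 \<le> (exp (V n))\<^sup>2"
        by (intro power_mono) auto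
      also have "(exp (V n))\<^sup>2 = exp (2 * V n)"
        by (simp add: exp_double)
      finally show "exp (- (2 * V n)) \<le> inverse ((1 + real n)\<^sup>2)"
        unfolding exp_minus by (intro le_imp_inverse_le) (auto intro!: zero_less_power)
      have "1 + rnorm \<nu> \<le> exp L"
        using exp_ge_add_one_self[of 1] by (simp add: L_def add_pos_nonneg)
      also have "\<dots> \<le> exp (V n)"
        using \<open>L \<le> V n\<close> by simp
      finally have "(1 + rnorm \<nu>) ^ (2 * CARD('d)) \<le> exp (V n) ^ (2 * CARD('d))"
        by (intro power_mono) auto
      also have "exp (V n) ^ (2 * CARD('d)) = exp (2 * real CARD('d) * V n)"
        by (simp flip: exp_of_nat_mult)
      finally show "exp (- (2 * real CARD('d) * V n)) \<le> inverse ((1 + rnorm \<nu>) ^ (2 * CARD('d)))"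
        unfolding exp_minus by (intro le_imp_inverse_le) (auto intro!: zero_less_power add_pos_nonneg)
    qed auto
    finally show ?thesis
      by (simp add: w_def)
  qed
  define Z where "Z p x = (if p \<in> I then ennreal (exp (- E * V (fst p))) *
      ennreal (exp (lam * Wloc (poly P) K (snd p) (fst p) x)) else 0)" for p x
  have meas: "(\<lambda>x. ennreal (exp (lam * Wloc (poly P) K \<nu> n x))) \<in> borel_measurable \<omega>" for \<nu> n
  proof -
    have "(\<lambda>x. Wloc (poly P) K \<nu> n x) \<in> borel_measurable \<omega>"
      unfolding measurable_cong_sets[OF sets refl]
      by (rule borel_measurable_continuous_onI[OF continuous_Wloc])
    then show ?thesis
      by measurable
  qed
  have "AE x in \<omega>. \<exists>B. \<forall>p. Z p x \<le> ennreal B"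
  proof (rule AE_countable_family_bounded[where S = "4 * 4 ^ CARD('d)"])
    show "Z p \<in> borel_measurable \<omega>" for p
      unfolding Z_def using meas by auto
    fix F :: "(nat \<times> (int ^ 'd)) set"
    assume "finite F"
    have "(\<Sum>p\<in>F. \<integral>\<^sup>+x. Z p x \<partial>\<omega>) \<le> (\<Sum>p\<in>F. ennreal (w p))"
    proof (rule sum_mono)
      fix p
      show "(\<integral>\<^sup>+x. Z p x \<partial>\<omega>) \<le> ennreal (w p)"
      proof (cases "p \<in> I")
        case True
        then have "(\<integral>\<^sup>+x. Z p x \<partial>\<omega>) = ennreal (exp (- E * V (fst p))) *
            (\<integral>\<^sup>+x. ennreal (exp (lam * Wloc (poly P) K (snd p) (fst p) x)) \<partial>\<omega>)"
          unfolding Z_def by (simp add: nn_integral_cmult[OF meas])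
        also have "\<dots> \<le> ennreal (exp (- E * V (fst p))) * ennreal (exp (C * V (fst p)))"
          unfolding V_def by (intro mult_left_mono moment) simp
        also have "\<dots> = ennreal (exp (- E * V (fst p)) * exp (C * V (fst p)))"
          by (simp add: ennreal_mult)
        also have "\<dots> \<le> ennreal (w p)"
          using decay[of "fst p" "snd p"] True by (intro ennreal_leI) simp
        finally show ?thesis .
      qed (simp add: Z_def)
    qed
    also have "\<dots> = ennreal (\<Sum>p\<in>F. w p)"
      using w_nonneg by simp
    also have "\<dots> \<le> ennreal (4 * 4 ^ CARD('d))"
      using sum_space_time_le[OF \<open>finite F\<close>] by (intro ennreal_leI) (auto simp: w_def case_prod_beta)
    finally show "(\<Sum>p\<in>F. \<integral>\<^sup>+x. Z p x \<partial>\<omega>) \<le> ennreal (4 * 4 ^ CARD('d))" .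
  qed
  then show ?thesis
  proof eventually_elim
    case (elim x)
    then obtain B0 where B0: "\<And>p. Z p x \<le> ennreal B0"
      by blast
    define B where "B = max 1 B0"
    have "1 \<le> B"
      by (simp add: B_def)
    have "Wloc (poly P) K \<nu> n x / (2 * real n + 1) ^ CARD('d) \<le> (ln B + E) / lam" if "(n, \<nu>) \<in> I" for n \<nu>
    proof -
      have "Z (n, \<nu>) x \<le> ennreal B"
        using B0[of "(n, \<nu>)"] by (rule order_trans) (auto simp: B_def intro: ennreal_leI)
      then have "exp (- E * V n) * exp (lam * Wloc (poly P) K \<nu> n x) \<le> exp (ln B)"
        using \<open>1 \<le> B\<close> that by (simp add: Z_def ennreal_mult[symmetric])
      then have "lam * Wloc (poly P) K \<nu> n x \<le> ln B + E * V n"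
        by (simp flip: exp_add)
      also have "\<dots> \<le> ln B * V n + E * V n"
        using V(2)[of n] \<open>1 \<le> B\<close> by (simp add: mult_le_cancel_left1)
      finally have "Wloc (poly P) K \<nu> n x \<le> (ln B + E) / lam * V n"
        using \<open>0 < lam\<close> by (simp add: field_simps)
      then show ?thesis
        using V(2)[of n] by (simp add: divide_le_eq flip: V_def)
    qed
    then have "Qfun (poly P) K x \<le> ereal ((ln B + E) / lam)"
      unfolding Qfun_def by (intro SUP_least) (auto simp: I_def)
    then show ?case
      by (auto simp: X0_def)
  qed
qed

end

theorem theorem2p2:
  fixes P :: "real poly" and K :: real
    and \<Phi> :: "real \<Rightarrow> 'd::finite cfg \<Rightarrow> 'd cfg" and \<omega> :: "'d cfg measure"
    and f g :: "real \<times> real \<Rightarrow> real" and f' g' :: "real \<times> real \<Rightarrow> real \<times> real \<Rightarrow> real"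
    and i :: "int ^ 'd" and \<alpha> b :: real
  assumes "K > 0"
    and "degree P = 4" and "lead_coeff P > 0" and "\<forall>s. poly P s \<ge> 0"
    and "is_flow (poly P) (poly (pderiv P)) K \<Phi>"
    and "time_invariant_state (poly P) K \<Phi> \<omega>"
    and "\<forall>z. (f has_derivative f' z) (at z)" and "bounded (range f)" and "bounded (range (\<lambda>z. onorm (f' z)))"
    and "\<forall>z. (g has_derivative g' z) (at z)" and "bounded (range g)" and "bounded (range (\<lambda>z. onorm (g' z)))"
    and "\<alpha> > 1 / 2" and "b > 0"
  shows "AE x in \<omega>.
     ((\<lambda>t. SUP j \<in> {j. real_of_int (ldist i j) > t * (ln t) powr \<alpha>}.
          ereal (exp (b * t) * pbracket (\<lambda>y. f (y i)) (\<lambda>y. g (\<Phi> t y j)) x))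
      \<longlongrightarrow> 0) at_top"
proof -
  interpret quartic_lattice P K \<Phi>
    using assms(1-5) by unfold_locales
  \<comment> \<open>Neither exceptional set depends on \<open>t\<close>, \<open>j\<close>,
    \<open>\<alpha>\<close> or \<open>b\<close>; off them the limit is a deterministic statement
    about a single orbit.\<close>
  show ?thesis
    using AE_phase_space[OF assms(6)] AE_site_en_bound[OF assms(6)]
  proof eventually_elim
    case (elim x)
    then show ?case
      using pbracket_light_cone[OF assms(7,9,10,12) elim(1) _ assms(13)] by blast
  qed
qed

end
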